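(* For every precondition $\varphi$, command $C$ and postcondition $\psi$ of Total Outcome Logic: if $\vdash \langle\varphi\rangle\, C\, \langle\psi\rangle$ is derivable in the proof system described below, then $\vDash \langle\varphi\rangle\, C\, \langle\psi\rangle$, i.e. for every $m\in\varphi$ we have $\llbracket C\rrbracket^\dagger(m)\in\psi$.
   Context: Weights. Fix a (possibly partial) semiring $\mathcal A=\langle U,+,\cdot,0,1\rangle$: $+$ is a (possibly partial) commutative associative operation with unit $0$, $\cdot$ is associative with unit $1$, $\cdot$ distributes over $+$, and $0$ annihilates. Assume $\mathcal A$ is naturally ordered ($u\le v$ iff $u+w=v$ for some $w$ defines a partial order), bounded with top element $\top$, Scott-continuous, and complete (countable sums $\sum_{i\in I}u_i$ are the suprema of finite partial sums). Weighting functions. Fix a set $\Sigma$ of program states and a fresh element $\natural\notin\Sigma$ representing nontermination; $\Sigma_\natural=\Sigma\cup\{\natural\}$, and for $P\subseteq\Sigma$, $P_\natural=P\cup\{\natural\}$. $\mathcal W(\Sigma_\natural)$ is the set of functions $m:\Sigma_\natural\to U$ whose mass $|m|=\sum_{\sigma\in\mathrm{supp}(m)}m(\sigma)$ is defined, where $\mathrm{supp}(m)=\{\sigma\mid m(\sigma)\ne 0\}$. Operations are pointwise: $(m_1+m_2)(\sigma)=m_1(\sigma)+m_2(\sigma)$, $(u\cdot m)(\sigma)=u\cdot m(\sigma)$, $(m\cdot u)(\sigma)=m(\sigma)\cdot u$. $\eta(x)(y)=1$ if $x=y$ and $0$ otherwise. For $f:\Sigma\to\mathcal W(\Sigma_\natural)$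 the Kleisli extension is $f^\dagger(m)(y)=\sum_{\sigma\in\mathrm{supp}(m)\cap\Sigma}m(\sigma)\cdot f(\sigma)(y)+m(\natural)\cdot\eta(\natural)(y)$. The fusion order is $m_1\sqsubseteq m_2$ iff $m_1(\sigma)\le m_2(\sigma)$ for all $\sigma\in\Sigma$ and $m_1(\natural)\ge m_2(\natural)$. Language. Commands $C::=\mathsf{skip}\mid \mathsf{assume}\ e\mid a\mid C_1;C_2\mid C_1+C_2\mid \mathsf{iter}(C,e_1,e_2)$, where $a$ ranges over atomic actions with given interpretation $\llbracket a\rrbracket:\Sigma\to\mathcal W(\Sigma_\natural)$, guards are $e::=b\mid u\in U$, and Boolean expressions $b$ are built from primitive tests $t\subseteq\Sigma$ with $\mathsf{true},\mathsf{false},\lor,\land,\lnot$; $\llbracket b\rrbracket(\sigma)\in\{0,1\}$ is the usual truth value and $\llbracket u\rrbracket(\sigma)=u$. Semantics $\llbracket C\rrbracket:\Sigma\to\mathcal W(\Sigma_\natural)$: $\llbracket\mathsf{skip}\rrbracket(\sigma)=\eta(\sigma)$; $\llbracket C_1;C_2\rrbracket(\sigma)=\llbracket C_2\rrbracket^\dagger(\llbracket C_1\rrbracket(\sigma))$; $\llbracket C_1+C_2\rrbracket(\sigma)=\llbracket C_1\rrbracket(\sigma)+\llbracket C_2\rrbracket(\sigma)$; $\llbracket\mathsf{assume}\ e\rrbracket(\sigma)=\llbracket e\rrbracket(\sigma)\cdot\eta(\sigma)$; $\llbracket\mathsf{iter}(C,e_1,e_2)\rrbracket$ is the least fixed point (for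 the pointwise fusion order on functions $\Sigma\to\mathcal W(\Sigma_\natural)$, whose existence the paper establishes under its standing domain restrictions) of $\Phi(f)(\sigma)=\llbracket e_1\rrbracket(\sigma)\cdot f^\dagger(\llbracket C\rrbracket(\sigma))+\llbracket e_2\rrbracket(\sigma)\cdot\eta(\sigma)$. Assertions are subsets of $\mathcal W(\Sigma_\natural)$; $m\vDash\varphi$ means $m\in\varphi$. $\top=\mathcal W(\Sigma_\natural)$, $\bot=\emptyset$, $\lnot,\lor,\land$ are complement, union, intersection, and $\varphi\Rightarrow\psi$ means $\varphi\subseteq\psi$ when used as a side condition. For $P\subseteq\Sigma$: $P^{(u)}=\{m\mid |m|=u,\ \mathrm{supp}(m)\subseteq P\}$; $\Uparrow^{(u)}=\{u\cdot\top\cdot\eta(\natural)\}$; $u\odot\varphi=\{u\cdot m\mid m\in\varphi\}$; $\varphi\odot u=\{m\cdot u\mid m\in\varphi\}$; $\mathbf 1_m=\{m\}$; $\exists x{:}T.\,\phi(x)=\bigcup_{t\in T}\phi(t)$; $\bigoplus_{x\in T}\phi(x)=\{\sum_{t\in T}m_t\mid \forall t.\ m_t\in\phi(t)\}$, with binary case $\varphi\oplus\psi$. A triple is valid, $\vDash\langle\varphi\rangle C\langle\psi\rangle$, iff $\llbracket C\rrbracket^\dagger(m)\in\psi$ for all $m\in\varphi$. Side conditions. $\varphi\vDash e=u$ iff every $m\in\varphi$ has $\natural\notin\mathrm{supp}(m)$ and $\llbracket e\rrbracket(\sigma)=u$ for all $\sigma\in\mathrm{supp}(m)$; $\varphi\vDash\mathsf{true}$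 iff every $m\in\varphi$ has $\natural\notin\mathrm{supp}(m)$. $\varphi\vDash\mathsf{div}$ iff every $m\in\varphi$ has $\mathrm{supp}(m)\subseteq\{\natural\}$. $(\psi_n)_{n\in\mathbb N}\rightsquigarrow\psi_\infty$ iff whenever $m_n\in\psi_n$ for all $n$, $\sum_n m_n\in\psi_\infty$. $(\psi_n)_{n\in\mathbb N}\Uparrow\psi_\infty$ iff whenever $m_n\in\psi_n$ for all $n$, $(\inf_n|m_n|\cdot\top)\cdot\eta(\natural)\in\psi_\infty$. Proof system ($\vdash$). Derivations may use as axioms a set $\Omega$ of semantically valid triples (containing the valid triples about atomic actions), with side conditions decided semantically, together with the rules: False: $\langle\bot\rangle C\langle\varphi\rangle$. True: $\langle\varphi\rangle C\langle\top\rangle$. Div: $\langle\Uparrow^{(u)}\rangle C\langle\Uparrow^{(u)}\rangle$. Scale: from $\langle\varphi\rangle C\langle\psi\rangle$ infer $\langle u\odot\varphi\rangle C\langle u\odot\psi\rangle$. Disj/Conj: from $\langle\varphi_i\rangle C\langle\psi_i\rangle$ ($i=1,2$) infer $\langle\varphi_1\lor\varphi_2\rangle C\langle\psi_1\lor\psi_2\rangle$, resp. with $\land$. Choice: from $\langle\phi(t)\rangle C\langle\phi'(t)\rangle$ for all $t\in T$ infer $\langle\bigoplus_{x\in T}\phi(x)\rangle C\langle\bigoplus_{x\in T}\phi'(x)\rangle$. Exists: same premises, conclude $\langle\exists x{:}T.\phi(x)\rangle C\langle\exists x{:}T.\phi'(x)\rangle$. Consequence: from $\varphi'\subseteq\varphi$,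 $\langle\varphi\rangle C\langle\psi\rangle$, $\psi\subseteq\psi'$ infer $\langle\varphi'\rangle C\langle\psi'\rangle$. Skip: $\langle\varphi\rangle\mathsf{skip}\langle\varphi\rangle$. Seq: from $\langle\varphi\rangle C_1\langle\zeta\rangle$, $\langle\zeta\rangle C_2\langle\psi\rangle$ infer $\langle\varphi\rangle C_1;C_2\langle\psi\rangle$. Plus: from $\varphi\vDash\mathsf{true}$, $\langle\varphi\rangle C_1\langle\psi_1\rangle$, $\langle\varphi\rangle C_2\langle\psi_2\rangle$ infer $\langle\varphi\rangle C_1+C_2\langle\psi_1\oplus\psi_2\rangle$. Assume: from $\varphi\vDash e=u$ infer $\langle\varphi\rangle\mathsf{assume}\ e\langle\varphi\odot u\rangle$. Iter: from $(\psi_n)_n\rightsquigarrow\psi_\infty$, $(\varphi_n\oplus\zeta_n)_n\Uparrow\zeta_\infty$, and for all $n$: $\varphi_n\vDash\mathsf{true}$, $\zeta_n\vDash\mathsf{div}$, $\langle\varphi_n\oplus\zeta_n\rangle\mathsf{assume}\ e;C\langle\varphi_{n+1}\oplus\zeta_{n+1}\rangle$, $\langle\varphi_n\rangle\mathsf{assume}\ e'\langle\psi_n\rangle$, infer $\langle\varphi_0\oplus\zeta_0\rangle\mathsf{iter}(C,e,e')\langle\psi_\infty\oplus\zeta_\infty\rangle$.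
   Formalization: The domain restrictions are made explicit: m(♮) has form u·⊤; f↦f†(m) preserves decreasing infima of weights u·⊤ (over Booleans: finite support or ♮ in it); such infima exist, with · and + continuous for them; sums in C1+C2 and iter must be defined. Without them rule Iter is unsound. *)

theory Defs
  imports "HOL-Library.Countable_Set"
begin

section \<open>Weights\<close>

context ord
begin

definition directed :: "'a set \<Rightarrow> bool" where
  "directed D \<longleftrightarrow> D \<noteq> {} \<and> (\<forall>x\<in>D. \<forall>y\<in>D. \<exists>z\<in>D. x \<le> z \<and> y \<le> z)"

definition is_lub :: "'a set \<Rightarrow> 'a \<Rightarrow> bool" where
  "is_lub D s \<longleftrightarrow> (\<forall>x\<in>D. x \<le> s) \<and> (\<forall>b. (\<forall>x\<in>D. x \<le> b) \<longrightarrow> s \<le> b)"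

definition is_glb :: "'a set \<Rightarrow> 'a \<Rightarrow> bool" where
  "is_glb D i \<longleftrightarrow> (\<forall>x\<in>D. i \<le> x) \<and> (\<forall>b. (\<forall>x\<in>D. b \<le> x) \<longrightarrow> b \<le> i)"

definition ascending :: "(nat \<Rightarrow> 'a) \<Rightarrow> bool" where
  "ascending x \<longleftrightarrow> (\<forall>n. x n \<le> x (Suc n))"

definition descending :: "(nat \<Rightarrow> 'a) \<Rightarrow> bool" where
  "descending x \<longleftrightarrow> (\<forall>n. x (Suc n) \<le> x n)"

end

text \<open>
  A partial semiring that is naturally ordered (with \<open>\<le>\<close> a partial order) and bounded by \<open>top\<close>.
  \<open>padd a b = None\<close> means that \<open>a + b\<close> is undefined. Commutativity and associativity hold as
  Kleene equations; distributivity is only required where the undistributed sum exists, as in the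
  probabilistic semiring on the interval from 0 to 1.
\<close>

class partial_semiring = monoid_mult + mult_zero + order_top +
  fixes padd :: "'a \<Rightarrow> 'a \<Rightarrow> 'a option"
  assumes padd_commute: "padd a b = padd b a"
    and padd_assoc: "Option.bind (padd a b) (\<lambda>s. padd s c) = Option.bind (padd b c) (\<lambda>s. padd a s)"
    and padd_0: "padd 0 a = Some a"
    and padd_distrib_left: "padd a b = Some s \<Longrightarrow> padd (c * a) (c * b) = Some (c * s)"
    and padd_distrib_right: "padd a b = Some s \<Longrightarrow> padd (a * c) (b * c) = Some (s * c)"
    and le_iff_padd: "a \<le> b \<longleftrightarrow> (\<exists>c. padd a c = Some b)"

text \<open>Scott continuity: directed suprema exist and are preserved by both operations.\<close>

class weight_semiring = partial_semiring +
  assumes directed_sup: "directed D \<Longrightarrow> \<exists>s. is_lub D s"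
    and padd_Scott: "directed D \<Longrightarrow> is_lub D s \<Longrightarrow> (\<forall>x\<in>D. padd x a \<noteq> None) \<Longrightarrow>
          \<exists>v. padd s a = Some v \<and> is_lub {w. \<exists>x\<in>D. padd x a = Some w} v"
    and mult_Scott_right: "directed D \<Longrightarrow> is_lub D s \<Longrightarrow> is_lub ((\<lambda>x. x * a) ` D) (s * a)"
    and mult_Scott_left: "directed D \<Longrightarrow> is_lub D s \<Longrightarrow> is_lub ((\<lambda>x. a * x) ` D) (a * s)"

text \<open>
  Lifting the partial addition to \<open>option\<close>, with \<open>None\<close> for ``undefined'', gives a total
  commutative monoid, so that finite partial sums are the library's \<open>sum\<close>.
\<close>

instantiation option :: (weight_semiring) comm_monoid_add
begin

definition zero_option :: "'a option" where
  "zero_option = Some 0"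

definition plus_option :: "'a option \<Rightarrow> 'a option \<Rightarrow> 'a option" where
  "plus_option x y = Option.bind x (\<lambda>a. Option.bind y (\<lambda>b. padd a b))"

instance
proof
  fix a b c :: "'a option"
  show "a + b + c = a + (b + c)"
    unfolding plus_option_def
    using padd_assoc by (cases a; cases b; cases c) auto
  show "a + b = b + a"
    unfolding plus_option_def
    using padd_commute by (cases a; cases b) auto
  show "0 + a = a"
    unfolding plus_option_def zero_option_def
    by (cases a) (auto simp: padd_0)
qed

end

text \<open>
  Countable sums are the suprema of their finite partial sums. The sum is defined iff all finite
  partial sums are and at most countably many summands are nonzero; the supremum then exists by
  \<open>directed_sup\<close>, so completeness needs no separate axiom. \<open>wsum\<close> is only meaningful on
  \<open>wsummable\<close> families.
\<close>

definition has_wsum :: "('i \<Rightarrow> 'u::weight_semiring) \<Rightarrow> 'i set \<Rightarrow> 'u \<Rightarrow> bool" where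
  "has_wsum f I s \<longleftrightarrow> countable {i\<in>I. f i \<noteq> 0} \<and>
     (\<forall>F. finite F \<and> F \<subseteq> I \<longrightarrow> (\<Sum>i\<in>F. Some (f i)) \<noteq> None) \<and>
     is_lub {v. \<exists>F. finite F \<and> F \<subseteq> I \<and> (\<Sum>i\<in>F. Some (f i)) = Some v} s"

definition wsummable :: "('i \<Rightarrow> 'u::weight_semiring) \<Rightarrow> 'i set \<Rightarrow> bool" where
  "wsummable f I \<longleftrightarrow> (\<exists>s. has_wsum f I s)"

definition wsum :: "('i \<Rightarrow> 'u::weight_semiring) \<Rightarrow> 'i set \<Rightarrow> 'u" where
  "wsum f I = (THE s. has_wsum f I s)"

text \<open>
  The weights a nonterminating outcome can carry. The fusion order reverses the order on these
  weights, so least fixed points need infima of decreasing sequences of them, and the operations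
  must be continuous for these infima: the dual of Scott continuity, confined to \<open>div_weights\<close>.
  For addition, continuity is for the fusion order (first summand increasing, second decreasing);
  constant \<open>a\<close> gives ordinary dual continuity, which implies the axiom if addition is total.
\<close>

definition (in weight_semiring) div_weights :: "'a set" where
  "div_weights = range (\<lambda>u. u * top)"

class fusion_semiring = weight_semiring +
  assumes div_inf: "range d \<subseteq> div_weights \<Longrightarrow> descending d \<Longrightarrow> \<exists>i. is_glb (range d) i"
    and div_mult_inf: "range d \<subseteq> div_weights \<Longrightarrow> descending d \<Longrightarrow> is_glb (range d) i \<Longrightarrow>
          is_glb (range (\<lambda>n. u * d n)) (u * i)"
    and div_padd_inf: "range a \<subseteq> div_weights \<Longrightarrow> ascending a \<Longrightarrow> is_lub (range a) s \<Longrightarrow>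
          range d \<subseteq> div_weights \<Longrightarrow> descending d \<Longrightarrow> is_glb (range d) i \<Longrightarrow>
          (\<And>n. \<exists>v. padd (a n) (d n) = Some v \<and> l \<le> v) \<Longrightarrow>
          \<exists>v. padd s i = Some v \<and> l \<le> v"


section \<open>Weighting functions\<close>

text \<open>
  Program states form a type \<open>'s\<close>; \<open>Some \<sigma>\<close> is the state \<open>\<sigma>\<close> and \<open>None\<close> is the
  element \<open>\<natural>\<close> representing nontermination.
\<close>

type_synonym ('s, 'u) weighting = "'s option \<Rightarrow> 'u"

definition supp :: "('s, 'u::weight_semiring) weighting \<Rightarrow> 's option set" where
  "supp m = {x. m x \<noteq> 0}"

definition mass :: "('s, 'u::weight_semiring) weighting \<Rightarrow> 'u" where
  "mass m = wsum m (supp m)"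

definition eta :: "'s option \<Rightarrow> ('s, 'u::weight_semiring) weighting" where
  "eta x = (\<lambda>y. if x = y then 1 else 0)"

definition lscale :: "'u::weight_semiring \<Rightarrow> ('s, 'u) weighting \<Rightarrow> ('s, 'u) weighting" where
  "lscale u m = (\<lambda>x. u * m x)"

definition rscale :: "('s, 'u::weight_semiring) weighting \<Rightarrow> 'u \<Rightarrow> ('s, 'u) weighting" where
  "rscale m u = (\<lambda>x. m x * u)"

definition wplus :: "('s, 'u::weight_semiring) weighting \<Rightarrow> ('s, 'u) weighting \<Rightarrow> ('s, 'u) weighting" where
  "wplus m1 m2 = (\<lambda>x. the (Some (m1 x) + Some (m2 x)))"

definition kleisli :: "('s \<Rightarrow> ('s, 'u::weight_semiring) weighting) \<Rightarrow> ('s, 'u) weighting \<Rightarrow> ('s, 'u) weighting" where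
  "kleisli f m = wplus (\<lambda>y. wsum (\<lambda>\<sigma>. m (Some \<sigma>) * f \<sigma> y) {\<sigma>. Some \<sigma> \<in> supp m})
                       (lscale (m None) (eta None))"

definition fusion_le :: "('s, 'u::weight_semiring) weighting \<Rightarrow> ('s, 'u) weighting \<Rightarrow> bool" where
  "fusion_le m1 m2 \<longleftrightarrow> (\<forall>\<sigma>. m1 (Some \<sigma>) \<le> m2 (Some \<sigma>)) \<and> m2 None \<le> m1 None"

text \<open>
  \<open>fusion_cont m\<close>: \<open>f \<mapsto> kleisli f m\<close> preserves limits of increasing sequences in the fusion
  order. On states this is Scott continuity, so only the weight of \<open>\<natural>\<close> matters.
  It excludes, e.g., unbounded nondeterminism over the Boolean semiring: \<open>m\<close> satisfies it there
  iff it has finite support or \<open>\<natural> \<in> supp m\<close>. With unbounded nondeterminism a loop may terminate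
  although for every \<open>n\<close> it has executions with more than \<open>n\<close> iterations, so least fixed points are
  not limits of finite iteration, and the rule for loops is unsound.
\<close>

definition fusion_cont :: "('s, 'u::weight_semiring) weighting \<Rightarrow> bool" where
  "fusion_cont m \<longleftrightarrow> (\<forall>d i.
     (\<forall>\<sigma>. range (\<lambda>n. d n \<sigma>) \<subseteq> div_weights \<and> descending (\<lambda>n. d n \<sigma>) \<and>
           is_glb (range (\<lambda>n. d n \<sigma>)) (i \<sigma>)) \<longrightarrow>
     is_glb (range (\<lambda>n. kleisli (\<lambda>\<sigma>. lscale (d n \<sigma>) (eta None)) m None))
       (kleisli (\<lambda>\<sigma>. lscale (i \<sigma>) (eta None)) m None))"

text \<open>
  \<open>wfuns\<close> is \<open>\<W>(\<Sigma>\<^sub>\<natural>)\<close>: mass is defined, with the domain restrictions under which the fusion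
  order has the required fixed points. Weights of \<open>\<natural>\<close> are restricted to \<open>div_weights\<close>, as in
  \<open>diverge\<close> below: the rule for loops multiplies masses by \<open>top\<close> and is unsound for the
  precondition \<open>{eta None}\<close> if \<open>top \<noteq> 1\<close>. If \<open>top = 1\<close>, as for the Boolean and the probabilistic
  semirings, then \<open>div_weights = UNIV\<close>; over the latter \<open>fusion_cont\<close> always holds, too.
\<close>

definition wfuns :: "('s, 'u::weight_semiring) weighting set" where
  "wfuns = {m. wsummable m (supp m) \<and> m None \<in> div_weights \<and> fusion_cont m}"


section \<open>Commands\<close>

datatype 's bexp =
    BTrue
  | BFalse
  | BTest "'s set"
  | BOr "'s bexp" "'s bexp"
  | BAnd "'s bexp" "'s bexp"
  | BNot "'s bexp"

datatype ('s, 'u) guard = Bool "'s bexp" | Weight 'u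

datatype ('a, 's, 'u) cmd =
    Skip
  | Assume "('s, 'u) guard"
  | Act 'a
  | Seq "('a, 's, 'u) cmd" "('a, 's, 'u) cmd"
  | Plus "('a, 's, 'u) cmd" "('a, 's, 'u) cmd"
  | Iter "('a, 's, 'u) cmd" "('s, 'u) guard" "('s, 'u) guard"

fun bval :: "'s bexp \<Rightarrow> 's \<Rightarrow> bool" where
  "bval BTrue \<sigma> = True"
| "bval BFalse \<sigma> = False"
| "bval (BTest t) \<sigma> = (\<sigma> \<in> t)"
| "bval (BOr b1 b2) \<sigma> = (bval b1 \<sigma> \<or> bval b2 \<sigma>)"
| "bval (BAnd b1 b2) \<sigma> = (bval b1 \<sigma> \<and> bval b2 \<sigma>)"
| "bval (BNot b) \<sigma> = (\<not> bval b \<sigma>)"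

fun gval :: "('s, 'u::weight_semiring) guard \<Rightarrow> 's \<Rightarrow> 'u" where
  "gval (Bool b) \<sigma> = (if bval b \<sigma> then 1 else 0)"
| "gval (Weight u) \<sigma> = u"

definition loop_op :: "('s \<Rightarrow> ('s, 'u::weight_semiring) weighting) \<Rightarrow> ('s, 'u) guard \<Rightarrow> ('s, 'u) guard
    \<Rightarrow> ('s \<Rightarrow> ('s, 'u) weighting) \<Rightarrow> 's \<Rightarrow> ('s, 'u) weighting" where
  "loop_op c e1 e2 f \<sigma> =
     wplus (lscale (gval e1 \<sigma>) (kleisli f (c \<sigma>))) (lscale (gval e2 \<sigma>) (eta (Some \<sigma>)))"

definition is_lfp :: "(('s \<Rightarrow> ('s, 'u::weight_semiring) weighting) \<Rightarrow> 's \<Rightarrow> ('s, 'u) weighting)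
    \<Rightarrow> ('s \<Rightarrow> ('s, 'u) weighting) \<Rightarrow> bool" where
  "is_lfp \<Phi> f \<longleftrightarrow> (\<forall>\<sigma>. f \<sigma> \<in> wfuns) \<and> \<Phi> f = f \<and>
     (\<forall>g. (\<forall>\<sigma>. g \<sigma> \<in> wfuns) \<and> \<Phi> g = g \<longrightarrow> (\<forall>\<sigma>. fusion_le (f \<sigma>) (g \<sigma>)))"

primrec den :: "('a \<Rightarrow> 's \<Rightarrow> ('s, 'u::weight_semiring) weighting) \<Rightarrow> ('a, 's, 'u) cmd
    \<Rightarrow> 's \<Rightarrow> ('s, 'u) weighting" where
  "den act Skip = (\<lambda>\<sigma>. eta (Some \<sigma>))"
| "den act (Assume e) = (\<lambda>\<sigma>. lscale (gval e \<sigma>) (eta (Some \<sigma>)))"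
| "den act (Act a) = act a"
| "den act (Seq C1 C2) = (\<lambda>\<sigma>. kleisli (den act C2) (den act C1 \<sigma>))"
| "den act (Plus C1 C2) = (\<lambda>\<sigma>. wplus (den act C1 \<sigma>) (den act C2 \<sigma>))"
| "den act (Iter C e1 e2) = (THE f. is_lfp (loop_op (den act C) e1 e2) f)"

text \<open>
  As addition is partial, the semantic equations denote maps \<open>\<Sigma> \<rightarrow> \<W>(\<Sigma>\<^sub>\<natural>)\<close> only if the
  additions in the clauses for \<open>Plus\<close> and \<open>Iter\<close> are defined; for \<open>Iter\<close> this says that \<open>loop_op\<close>
  is an operator on \<open>\<Sigma> \<rightarrow> \<W>(\<Sigma>\<^sub>\<natural>)\<close>.
\<close>

definition wplus_defined :: "('s, 'u::weight_semiring) weighting \<Rightarrow> ('s, 'u) weighting \<Rightarrow> bool" where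
  "wplus_defined m1 m2 \<longleftrightarrow> (\<forall>x. Some (m1 x) + Some (m2 x) \<noteq> None) \<and> wplus m1 m2 \<in> wfuns"

primrec well_defined :: "('a \<Rightarrow> 's \<Rightarrow> ('s, 'u::weight_semiring) weighting) \<Rightarrow> ('a, 's, 'u) cmd \<Rightarrow> bool" where
  "well_defined act Skip = True"
| "well_defined act (Assume e) = True"
| "well_defined act (Act a) = True"
| "well_defined act (Seq C1 C2) = (well_defined act C1 \<and> well_defined act C2)"
| "well_defined act (Plus C1 C2) = (well_defined act C1 \<and> well_defined act C2 \<and>
     (\<forall>\<sigma>. wplus_defined (den act C1 \<sigma>) (den act C2 \<sigma>)))"
| "well_defined act (Iter C e1 e2) = (well_defined act C \<and>
     (\<forall>f. (\<forall>\<sigma>. f \<sigma> \<in> wfuns) \<longrightarrow>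
       (\<forall>\<sigma>. wplus_defined (lscale (gval e1 \<sigma>) (kleisli f (den act C \<sigma>)))
                           (lscale (gval e2 \<sigma>) (eta (Some \<sigma>))))))"


section \<open>Assertions\<close>

text \<open>Assertions are the subsets of \<open>wfuns\<close>; sums that are undefined are not members.\<close>

type_synonym ('s, 'u) assn = "('s, 'u) weighting set"

definition is_assn :: "('s, 'u::weight_semiring) assn \<Rightarrow> bool" where
  "is_assn \<phi> \<longleftrightarrow> \<phi> \<subseteq> wfuns"

definition diverge :: "'u::weight_semiring \<Rightarrow> ('s, 'u) assn" where
  "diverge u = {lscale (u * top) (eta None)}"

definition lscale_assn :: "'u::weight_semiring \<Rightarrow> ('s, 'u) assn \<Rightarrow> ('s, 'u) assn" where
  "lscale_assn u \<phi> = lscale u ` \<phi>"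

definition rscale_assn :: "('s, 'u::weight_semiring) assn \<Rightarrow> 'u \<Rightarrow> ('s, 'u) assn" where
  "rscale_assn \<phi> u = (\<lambda>m. rscale m u) ` \<phi>"

definition bigoplus :: "'t set \<Rightarrow> ('t \<Rightarrow> ('s, 'u::weight_semiring) assn) \<Rightarrow> ('s, 'u) assn" where
  "bigoplus T \<phi> = {m \<in> wfuns. \<exists>ms. (\<forall>t\<in>T. ms t \<in> \<phi> t) \<and> (\<forall>x. has_wsum (\<lambda>t. ms t x) T (m x))}"

definition oplus :: "('s, 'u::weight_semiring) assn \<Rightarrow> ('s, 'u) assn \<Rightarrow> ('s, 'u) assn" where
  "oplus \<phi> \<psi> = {m \<in> wfuns. \<exists>m1\<in>\<phi>. \<exists>m2\<in>\<psi>. \<forall>x. Some (m1 x) + Some (m2 x) = Some (m x)}"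

definition valid :: "('a \<Rightarrow> 's \<Rightarrow> ('s, 'u::weight_semiring) weighting) \<Rightarrow>
    ('s, 'u) assn \<Rightarrow> ('a, 's, 'u) cmd \<Rightarrow> ('s, 'u) assn \<Rightarrow> bool" where
  "valid act \<phi> C \<psi> \<longleftrightarrow> (\<forall>m\<in>\<phi>. kleisli (den act C) m \<in> \<psi>)"

definition entails_guard :: "('s, 'u::weight_semiring) assn \<Rightarrow> ('s, 'u) guard \<Rightarrow> 'u \<Rightarrow> bool" where
  "entails_guard \<phi> e u \<longleftrightarrow>
     (\<forall>m\<in>\<phi>. None \<notin> supp m \<and> (\<forall>\<sigma>. Some \<sigma> \<in> supp m \<longrightarrow> gval e \<sigma> = u))"

definition entails_true :: "('s, 'u::weight_semiring) assn \<Rightarrow> bool" where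
  "entails_true \<phi> \<longleftrightarrow> (\<forall>m\<in>\<phi>. None \<notin> supp m)"

definition entails_div :: "('s, 'u::weight_semiring) assn \<Rightarrow> bool" where
  "entails_div \<phi> \<longleftrightarrow> (\<forall>m\<in>\<phi>. supp m \<subseteq> {None})"

definition converges :: "(nat \<Rightarrow> ('s, 'u::weight_semiring) assn) \<Rightarrow> ('s, 'u) assn \<Rightarrow> bool" where
  "converges \<psi> \<psi>' \<longleftrightarrow> (\<forall>ms. (\<forall>n. ms n \<in> \<psi> n) \<longrightarrow>
     (\<exists>m\<in>\<psi>'. \<forall>x. has_wsum (\<lambda>n. ms n x) UNIV (m x)))"

definition diverges :: "(nat \<Rightarrow> ('s, 'u::weight_semiring) assn) \<Rightarrow> ('s, 'u) assn \<Rightarrow> bool" where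
  "diverges \<psi> \<psi>' \<longleftrightarrow> (\<forall>ms. (\<forall>n. ms n \<in> \<psi> n) \<longrightarrow>
     (\<exists>i. is_glb (range (\<lambda>n. mass (ms n) * top)) i \<and> lscale i (eta None) \<in> \<psi>'))"


section \<open>Proof system\<close>

definition axiom_set :: "('a \<Rightarrow> 's \<Rightarrow> ('s, 'u::weight_semiring) weighting) \<Rightarrow>
    (('s, 'u) assn \<times> ('a, 's, 'u) cmd \<times> ('s, 'u) assn) set \<Rightarrow> bool" where
  "axiom_set act \<Omega> \<longleftrightarrow>
     (\<forall>\<phi> C \<psi>. (\<phi>, C, \<psi>) \<in> \<Omega> \<longrightarrow> is_assn \<phi> \<and> is_assn \<psi> \<and> valid act \<phi> C \<psi>) \<and>
     (\<forall>\<phi> a \<psi>. is_assn \<phi> \<and> is_assn \<psi> \<and> valid act \<phi> (Act a) \<psi> \<longrightarrow> (\<phi>, Act a, \<psi>) \<in> \<Omega>)"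

text \<open>
  The type argument is the type over which the index sets \<open>T\<close> of the rules \<open>Choice\<close> and
  \<open>Exists\<close> range. Premises \<open>is_assn\<close> are given for the assertions that are not already
  subsets of \<open>wfuns\<close> because of the other premises.
\<close>

inductive derivable :: "'t itself \<Rightarrow> (('s, 'u::weight_semiring) assn \<times> ('a, 's, 'u) cmd \<times> ('s, 'u) assn) set
    \<Rightarrow> ('s, 'u) assn \<Rightarrow> ('a, 's, 'u) cmd \<Rightarrow> ('s, 'u) assn \<Rightarrow> bool"
  for ty :: "'t itself" and \<Omega>
where
  Axiom: "(\<phi>, C, \<psi>) \<in> \<Omega> \<Longrightarrow> derivable ty \<Omega> \<phi> C \<psi>"
| False: "is_assn \<phi> \<Longrightarrow> derivable ty \<Omega> {} C \<phi>"
| True: "is_assn \<phi> \<Longrightarrow> derivable ty \<Omega> \<phi> C wfuns"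
| Div: "derivable ty \<Omega> (diverge u) C (diverge u)"
| Scale: "derivable ty \<Omega> \<phi> C \<psi> \<Longrightarrow> derivable ty \<Omega> (lscale_assn u \<phi>) C (lscale_assn u \<psi>)"
| Disj: "derivable ty \<Omega> \<phi>1 C \<psi>1 \<Longrightarrow> derivable ty \<Omega> \<phi>2 C \<psi>2 \<Longrightarrow>
    derivable ty \<Omega> (\<phi>1 \<union> \<phi>2) C (\<psi>1 \<union> \<psi>2)"
| Conj: "derivable ty \<Omega> \<phi>1 C \<psi>1 \<Longrightarrow> derivable ty \<Omega> \<phi>2 C \<psi>2 \<Longrightarrow>
    derivable ty \<Omega> (\<phi>1 \<inter> \<phi>2) C (\<psi>1 \<inter> \<psi>2)"
| Choice: "(\<And>t. t \<in> (T :: 't set) \<Longrightarrow> derivable ty \<Omega> (\<phi> t) C (\<phi>' t)) \<Longrightarrow>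
    derivable ty \<Omega> (bigoplus T \<phi>) C (bigoplus T \<phi>')"
| Exists: "(\<And>t. t \<in> (T :: 't set) \<Longrightarrow> derivable ty \<Omega> (\<phi> t) C (\<phi>' t)) \<Longrightarrow>
    derivable ty \<Omega> (\<Union>t\<in>T. \<phi> t) C (\<Union>t\<in>T. \<phi>' t)"
| Consequence: "\<phi>' \<subseteq> \<phi> \<Longrightarrow> derivable ty \<Omega> \<phi> C \<psi> \<Longrightarrow> \<psi> \<subseteq> \<psi>' \<Longrightarrow> is_assn \<psi>' \<Longrightarrow>
    derivable ty \<Omega> \<phi>' C \<psi>'"
| Skip: "is_assn \<phi> \<Longrightarrow> derivable ty \<Omega> \<phi> Skip \<phi>"
| Seq: "derivable ty \<Omega> \<phi> C1 \<zeta> \<Longrightarrow> derivable ty \<Omega> \<zeta> C2 \<psi> \<Longrightarrow> derivable ty \<Omega> \<phi> (Seq C1 C2) \<psi>"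
| Plus: "entails_true \<phi> \<Longrightarrow> derivable ty \<Omega> \<phi> C1 \<psi>1 \<Longrightarrow> derivable ty \<Omega> \<phi> C2 \<psi>2 \<Longrightarrow>
    derivable ty \<Omega> \<phi> (Plus C1 C2) (oplus \<psi>1 \<psi>2)"
| Assume: "is_assn \<phi> \<Longrightarrow> entails_guard \<phi> e u \<Longrightarrow>
    derivable ty \<Omega> \<phi> (Assume e) (rscale_assn \<phi> u)"
| Iter: "is_assn \<psi>_inf \<Longrightarrow> is_assn \<zeta>_inf \<Longrightarrow> (\<And>n. is_assn (\<zeta> n)) \<Longrightarrow>
    converges \<psi> \<psi>_inf \<Longrightarrow> diverges (\<lambda>n. oplus (\<phi> n) (\<zeta> n)) \<zeta>_inf \<Longrightarrow>
    (\<And>n. entails_true (\<phi> n)) \<Longrightarrow> (\<And>n. entails_div (\<zeta> n)) \<Longrightarrow>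
    (\<And>n. derivable ty \<Omega> (oplus (\<phi> n) (\<zeta> n)) (Seq (Assume e) C) (oplus (\<phi> (Suc n)) (\<zeta> (Suc n)))) \<Longrightarrow>
    (\<And>n. derivable ty \<Omega> (\<phi> n) (Assume e') (\<psi> n)) \<Longrightarrow>
    derivable ty \<Omega> (oplus (\<phi> 0) (\<zeta> 0)) (Iter C e e') (oplus \<psi>_inf \<zeta>_inf)"

end

(* Proof idea. Partial sums are handled in the weights extended by a greatest element "undefined",
   where addition is total and Scott continuous, so that arbitrary sums exist and commute. Soundness
   of every rule but the one for loops is then linearity of Kleisli extension.

   For a loop, the finite unrollings started at top * eta(natural) increase in the fusion order. Their
   limit is taken by suprema on states and infima at natural; it is a fixed point because the body
   satisfies fusion_cont. That the limit satisfies fusion_cont itself is the delicate point: at a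
   divergence weight it is a sum of an increasing and a decreasing part, to which div_padd_inf
   applies, and each unrolling dominates the limit there. For the loop rule, n unrollings run from
   m_0 yield on states the sum of the first n exit weightings, and at natural |m_n| * top, since an
   unfinished run diverges with weight top. Both pass to the limit, the latter because m_0 satisfies
   fusion_cont. *)

theory Submission
  imports Defs
begin

section \<open>Extended weights and their sums\<close>

text \<open>Suprema and infima are treated asymmetrically. For suprema, partiality is harmless: a
  directed set of extended weights either contains \<open>None\<close>, which is then its supremum,
  or consists of weights, and directed suprema of weights are weights. So an infinite sum is
  \<open>None\<close> exactly if some finite partial sum is, and sums can be interchanged without
  summability hypotheses. Distributivity does not extend in this way: for probabilities, 1/2 * 1 +
  1/2 * 1 is defined although 1 + 1 is not. Products are therefore moved through sums only where the
  undistributed sum is known to be defined, and this is what statements ending in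
  \<open>Some\<close> secure. Infima have no such calculus: infinite sums need not commute with
  decreasing limits, not even for divergence weights. This is why \<open>fusion_cont\<close> is part
  of membership in \<open>wfuns\<close> and has to be reestablished for every construction.\<close>

text \<open>\<open>None\<close>, an undefined sum, is the greatest element, unlike in \<open>HOL-Library.Option_ord\<close>.\<close>

instantiation option :: (weight_semiring) canonically_ordered_monoid_add
begin

definition less_eq_option :: "'a option \<Rightarrow> 'a option \<Rightarrow> bool" where
  "less_eq_option x y \<longleftrightarrow> (\<exists>z. y = x + z)"

definition less_option :: "'a option \<Rightarrow> 'a option \<Rightarrow> bool" where
  "less_option x y \<longleftrightarrow> x \<le> y \<and> \<not> y \<le> (x::'a option)"

instance
proof
  fix x y z :: "'a option"
  show le: "x \<le> y \<longleftrightarrow> (\<exists>z. y = x + z)" for x y :: "'a option"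
    by (simp add: less_eq_option_def)
  show "x < y \<longleftrightarrow> x \<le> y \<and> \<not> y \<le> x" by (simp add: less_option_def)
  show "x \<le> x" unfolding le by (intro exI[of _ 0]) simp
  show "x \<le> y \<Longrightarrow> y \<le> z \<Longrightarrow> x \<le> z" unfolding le by (auto simp: add.assoc)
  show "x \<le> y \<Longrightarrow> y \<le> x \<Longrightarrow> x = y"
  proof -
    assume a: "x \<le> y" "y \<le> x"
    then obtain u v where uv: "y = x + u" "x = y + v" unfolding le by blast
    show "x = y"
    proof (cases x)
      case None
      then show ?thesis using uv(1) by (simp add: plus_option_def)
    next
      case x: (Some a)
      then obtain b where y: "y = Some b"
        using uv(2) by (cases y) (auto simp: plus_option_def)
      have "a \<le> b"
        using uv(1) unfolding x y le_iff_padd by (cases u) (auto simp: plus_option_def)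
      moreover have "b \<le> a"
        using uv(2) unfolding x y le_iff_padd by (cases v) (auto simp: plus_option_def)
      ultimately show ?thesis using x y by simp
    qed
  qed
qed

end

lemma Some_plus_Some: "Some a + Some b = padd a b"
  by (simp add: plus_option_def)

lemma None_plus [simp]: "None + x = None" "x + None = None"
  by (simp_all add: plus_option_def split: Option.bind_split)

lemma Some_0 [simp]: "Some 0 = 0"
  by (simp add: zero_option_def)

lemma Some_eq_0_iff [simp]: "Some a = 0 \<longleftrightarrow> a = 0"
  by (simp add: zero_option_def del: Some_0)

lemma le_None [simp]: "x \<le> None"
  unfolding less_eq_option_def by (metis None_plus(2))

lemma None_le_iff [simp]: "None \<le> x \<longleftrightarrow> x = None"
  unfolding less_eq_option_def by auto

lemma Some_le_Some [simp]: "Some a \<le> Some b \<longleftrightarrow> a \<le> b"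
proof -
  have "Some a \<le> Some b \<longleftrightarrow> (\<exists>z. Some b = Some a + z)" by (simp add: less_eq_option_def)
  also have "\<dots> \<longleftrightarrow> (\<exists>c. Some b = Some a + Some c)"
    by (metis None_plus(2) not_None_eq option.distinct(1))
  finally show ?thesis by (simp add: Some_plus_Some le_iff_padd eq_commute)
qed

lemma le_SomeE:
  assumes "x \<le> Some b"
  obtains a where "x = Some a" "a \<le> b"
  using assms by (cases x) auto

lemma weight_ge_0 [simp]: "0 \<le> (a::'u::weight_semiring)"
  by (auto simp: le_iff_padd padd_0)

lemma weight_le_0_iff [simp]: "a \<le> 0 \<longleftrightarrow> a = (0::'u::weight_semiring)"
  by (metis antisym weight_ge_0)

lemma weight_mult_left_mono: "a \<le> b \<Longrightarrow> c * a \<le> c * (b::'u::weight_semiring)"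
  by (meson le_iff_padd padd_distrib_left)

lemma weight_mult_right_mono: "a \<le> b \<Longrightarrow> a * c \<le> b * (c::'u::weight_semiring)"
  by (meson le_iff_padd padd_distrib_right)

section \<open>Suprema and Scott continuity for extended weights\<close>

lemma is_lub_unique: "is_lub D s \<Longrightarrow> is_lub D t \<Longrightarrow> s = (t::'a::order)"
  unfolding is_lub_def by (meson order_antisym)

lemma is_glb_unique: "is_glb D s \<Longrightarrow> is_glb D t \<Longrightarrow> s = (t::'a::order)"
  unfolding is_glb_def by (meson order_antisym)

lemma is_lub_le_iff: "is_lub D s \<Longrightarrow> s \<le> b \<longleftrightarrow> (\<forall>x\<in>D. x \<le> (b::'a::order))"
  unfolding is_lub_def by (meson order_trans)

lemma is_lubI_le_iff: "(\<And>b. s \<le> b \<longleftrightarrow> (\<forall>x\<in>D. x \<le> b)) \<Longrightarrow> is_lub D (s::'a::order)"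
  unfolding is_lub_def by auto

lemma is_lub_Some_iff: "is_lub (Some ` D) (Some s) \<longleftrightarrow> is_lub D s"
proof
  assume "is_lub D s"
  then show "is_lub (Some ` D) (Some s)"
    by (intro is_lubI_le_iff; case_tac b) (auto simp: is_lub_le_iff)
next
  assume l: "is_lub (Some ` D) (Some s)"
  show "is_lub D s"
    using is_lub_le_iff[OF l, of "Some _"] by (intro is_lubI_le_iff) simp
qed

lemma directed_Some_iff: "directed (Some ` D) \<longleftrightarrow> directed D"
  by (auto simp: directed_def)

lemma option_set_cases:
  obtains "None \<in> D" | D' where "D = Some ` D'"
proof (cases "None \<in> D")
  case False
  have "D = Some ` (the ` D)"
    using False by (auto simp: image_image cong: image_cong_simp) (metis image_eqI option.collapse)+
  with that show ?thesis by blast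
qed (use that in blast)

lemma option_directed_sup:
  fixes D :: "'u::weight_semiring option set"
  assumes "directed D"
  shows "\<exists>s. is_lub D s"
proof (cases D rule: option_set_cases)
  case 1
  then have "is_lub D None" by (auto simp: is_lub_def)
  then show ?thesis ..
next
  case (2 D')
  then show ?thesis
    using assms directed_sup[of D'] is_lub_Some_iff[of D'] by (auto simp: directed_Some_iff)
qed

text \<open>If some \<open>x + a\<close> is undefined, the greatest element is attained and is the
  supremum. Otherwise \<open>a\<close> and all of \<open>D\<close> are weights, and
  \<open>padd_Scott\<close> also gives that \<open>s + a\<close> is defined.\<close>

lemma option_add_Scott:
  fixes D :: "'u::weight_semiring option set"
  assumes D: "directed D" and s: "is_lub D s"
  shows "is_lub ((\<lambda>x. x + a) ` D) (s + a)"
proof -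
  have ub: "x + a \<le> s + a" if "x \<in> D" for x
    using that s by (auto simp: is_lub_def add_right_mono)
  have None: "is_lub ((\<lambda>x. x + a) ` D) (s + a)" if "x \<in> D" "x + a = None" for x
    using that ub[of x] by (force simp: is_lub_def)
  show ?thesis
  proof (cases "\<exists>x\<in>D. x + a = None")
    case True
    with None show ?thesis by blast
  next
    case False
    then have "None \<notin> D" by auto
    then obtain D' where D': "D = Some ` D'"
      by (cases D rule: option_set_cases) auto
    obtain x where "x \<in> D" using D by (auto simp: directed_def)
    with False obtain a' where a: "a = Some a'" by (cases a) auto
    have dir: "directed D'" using D D' by (simp add: directed_Some_iff)
    then obtain s' where s': "is_lub D' s'" using directed_sup by blast
    with s have s_eq: "s = Some s'"
      using is_lub_unique unfolding D' is_lub_Some_iff[symmetric] by blast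
    have "\<forall>x\<in>D'. padd x a' \<noteq> None"
      using False by (auto simp: D' a Some_plus_Some)
    from padd_Scott[OF dir s' this] obtain v where
      v: "padd s' a' = Some v" "is_lub {w. \<exists>x\<in>D'. padd x a' = Some w} v" by blast
    have "(\<lambda>x. x + a) ` D = Some ` {w. \<exists>x\<in>D'. padd x a' = Some w}"
      using False by (force simp: D' a Some_plus_Some image_iff)
    then show ?thesis
      using v by (simp add: s_eq a Some_plus_Some is_lub_Some_iff)
  qed
qed

lemma option_add_Scott_left:
  fixes D :: "'u::weight_semiring option set"
  shows "directed D \<Longrightarrow> is_lub D s \<Longrightarrow> is_lub ((\<lambda>x. a + x) ` D) (a + s)"
  using option_add_Scott[of D s a] by (simp add: add.commute)

lemma ascending_le: "ascending x \<Longrightarrow> m \<le> n \<Longrightarrow> x m \<le> (x n :: 'a::order)"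
  unfolding ascending_def by (rule lift_Suc_mono_le) auto

lemma directed_range_ascending: "ascending (x :: nat \<Rightarrow> 'a::order) \<Longrightarrow> directed (range x)"
proof -
  assume x: "ascending x"
  have "\<exists>z\<in>range x. x m \<le> z \<and> x n \<le> z" for m n
    by (intro bexI[of _ "x (max m n)"]) (simp_all add: ascending_le[OF x])
  then show ?thesis by (auto simp: directed_def)
qed

lemma is_lub_range_Some_iff: "is_lub (range (\<lambda>n. Some (x n))) (Some s) \<longleftrightarrow> is_lub (range x) s"
  using is_lub_Some_iff[of "range x" s] by (simp add: image_image)

text \<open>The sums \<open>x m + y n\<close> have the same upper bounds as their diagonal, since
  \<open>max m n\<close> dominates both indices; the suprema can then be taken in one argument at a
  time.\<close>

lemma is_lub_range_add:
  fixes x y :: "nat \<Rightarrow> 'u::weight_semiring option"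
  assumes x: "ascending x" "is_lub (range x) s" and y: "ascending y" "is_lub (range y) t"
  shows "is_lub (range (\<lambda>n. x n + y n)) (s + t)"
  unfolding is_lub_def
proof (intro conjI ballI allI impI)
  fix z assume "z \<in> range (\<lambda>n. x n + y n)"
  then show "z \<le> s + t" using x y by (auto simp: is_lub_def intro: add_mono)
next
  fix b assume b: "\<forall>z\<in>range (\<lambda>n. x n + y n). z \<le> b"
  have b': "x m + y n \<le> b" for m n
  proof -
    have "x m + y n \<le> x (max m n) + y (max m n)"
      by (intro add_mono ascending_le[OF x(1)] ascending_le[OF y(1)]) simp_all
    also have "\<dots> \<le> b" using b by auto
    finally show ?thesis .
  qed
  have "s + y n \<le> b" for n
    using b' by (simp add: is_lub_le_iff[OF option_add_Scott[OF directed_range_ascending[OF x(1)] x(2)]])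
  then show "s + t \<le> b"
    by (simp add: is_lub_le_iff[OF option_add_Scott_left[OF directed_range_ascending[OF y(1)] y(2)]])
qed

section \<open>Sums of extended weights over arbitrary index sets\<close>

definition esum :: "('i \<Rightarrow> 'u::weight_semiring option) \<Rightarrow> 'i set \<Rightarrow> 'u option" where
  "esum f I = (THE s. is_lub (sum f ` {F. finite F \<and> F \<subseteq> I}) s)"

lemma directed_finite_sums:
  "directed (sum (f :: _ \<Rightarrow> 'u::weight_semiring option) ` {F. finite F \<and> F \<subseteq> I})"
  unfolding directed_def
proof (intro conjI ballI)
  fix x y
  assume "x \<in> sum f ` {F. finite F \<and> F \<subseteq> I}" "y \<in> sum f ` {F. finite F \<and> F \<subseteq> I}"
  then obtain F G where "finite F" "F \<subseteq> I" "x = sum f F" "finite G" "G \<subseteq> I" "y = sum f G" by auto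
  then show "\<exists>z\<in>sum f ` {F. finite F \<and> F \<subseteq> I}. x \<le> z \<and> y \<le> z"
    by (intro bexI[of _ "sum f (F \<union> G)"]) (auto intro: sum_mono2)
qed auto

text \<open>Finite partial sums are directed because the order is defined by addition, so further
  summands only increase a sum. Hence the \<open>THE\<close> in \<open>esum\<close> denotes for
  every \<open>f\<close> and \<open>I\<close>.\<close>

lemma is_lub_esum: "is_lub (sum f ` {F. finite F \<and> F \<subseteq> I}) (esum f I)"
  unfolding esum_def
proof -
  obtain s where s: "is_lub (sum f ` {F. finite F \<and> F \<subseteq> I}) s"
    using option_directed_sup[OF directed_finite_sums] by blast
  then show "is_lub (sum f ` {F. finite F \<and> F \<subseteq> I})
    (THE s. is_lub (sum f ` {F. finite F \<and> F \<subseteq> I}) s)"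
    using is_lub_unique[OF _ s] by (rule theI)
qed

lemma esum_le_iff: "esum f I \<le> b \<longleftrightarrow> (\<forall>F. finite F \<longrightarrow> F \<subseteq> I \<longrightarrow> sum f F \<le> b)"
  using is_lub_le_iff[OF is_lub_esum] by auto

lemma esum_eqI: "(\<And>b. esum f I \<le> b \<longleftrightarrow> s \<le> b) \<Longrightarrow> esum f I = s"
  by (meson order_antisym order_refl)

lemma sum_le_esum: "finite F \<Longrightarrow> F \<subseteq> I \<Longrightarrow> sum f F \<le> esum f I"
  using esum_le_iff by blast

lemma le_esum: "i \<in> I \<Longrightarrow> f i \<le> esum f I"
  using sum_le_esum[of "{i}"] by auto

lemma esum_mono: "(\<And>i. i \<in> I \<Longrightarrow> f i \<le> g i) \<Longrightarrow> esum f I \<le> esum g I"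
  unfolding esum_le_iff
proof (intro allI impI)
  fix F assume le: "\<And>i. i \<in> I \<Longrightarrow> f i \<le> g i" and F: "finite F" "F \<subseteq> I"
  then have "sum f F \<le> sum g F" by (intro sum_mono) auto
  also have "\<dots> \<le> esum g I" using F by (rule sum_le_esum)
  finally show "sum f F \<le> esum g I" .
qed

lemma esum_cong: "(\<And>i. i \<in> I \<Longrightarrow> f i = g i) \<Longrightarrow> esum f I = esum g I"
  by (intro order_antisym esum_mono) auto

lemma esum_finite: "finite I \<Longrightarrow> esum f I = sum f I"
  by (intro order_antisym sum_le_esum) (auto simp: esum_le_iff intro: sum_mono2)

lemma esum_mono_neutral:
  assumes "I \<subseteq> J" "\<And>i. i \<in> J - I \<Longrightarrow> f i = 0"
  shows "esum f I = esum f J"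
proof (rule order_antisym)
  show "esum f I \<le> esum f J"
    using assms(1) by (auto simp: esum_le_iff intro: sum_le_esum)
  show "esum f J \<le> esum f I"
    unfolding esum_le_iff
  proof (intro allI impI)
    fix F assume F: "finite F" "F \<subseteq> J"
    have "sum f F = sum f (F \<inter> I)"
      using F assms by (intro sum.mono_neutral_right) auto
    also have "\<dots> \<le> esum f I" using F by (intro sum_le_esum) auto
    finally show "sum f F \<le> esum f I" .
  qed
qed

lemma esum_neutral: "(\<And>i. i \<in> I \<Longrightarrow> f i = 0) \<Longrightarrow> esum f I = 0"
  using esum_mono_neutral[of "{}" I f] by (simp add: esum_finite)

lemma esum_single: "i \<in> I \<Longrightarrow> (\<And>j. j \<in> I \<Longrightarrow> j \<noteq> i \<Longrightarrow> f j = 0) \<Longrightarrow> esum f I = f i"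
  using esum_mono_neutral[of "{i}" I f] by (simp add: esum_finite)

lemma esum_reindex:
  assumes "inj_on h I"
  shows "esum f (h ` I) = esum (\<lambda>i. f (h i)) I"
proof (rule esum_eqI)
  fix b
  have eq: "sum f (h ` F) = (\<Sum>i\<in>F. f (h i))" if "F \<subseteq> I" for F
    using sum.reindex[OF inj_on_subset[OF assms that], of f] by simp
  show "esum f (h ` I) \<le> b \<longleftrightarrow> esum (\<lambda>i. f (h i)) I \<le> b"
    unfolding esum_le_iff
  proof (intro iffI allI impI)
    fix F assume "\<forall>F. finite F \<longrightarrow> F \<subseteq> h ` I \<longrightarrow> sum f F \<le> b" "finite F" "F \<subseteq> I"
    then have "sum f (h ` F) \<le> b" by (simp add: image_mono)
    then show "(\<Sum>i\<in>F. f (h i)) \<le> b" by (simp add: eq \<open>F \<subseteq> I\<close>)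
  next
    fix G assume b: "\<forall>F. finite F \<longrightarrow> F \<subseteq> I \<longrightarrow> (\<Sum>i\<in>F. f (h i)) \<le> b"
      and "finite G" "G \<subseteq> h ` I"
    then obtain F where "finite F" "F \<subseteq> I" "G = h ` F" using finite_subset_image by metis
    then show "sum f G \<le> b" using b eq by simp
  qed
qed

text \<open>A sum of \<open>f\<close> over \<open>F\<close> and a sum of \<open>g\<close> over
  \<open>G\<close> are both absorbed by the sum of \<open>f i + g i\<close> over the union. Scott
  continuity then passes to the supremum over \<open>F\<close> and over \<open>G\<close>
  separately.\<close>

lemma esum_add: "esum (\<lambda>i. f i + g i) I = esum f I + esum g I"
proof (rule order_antisym)
  show "esum (\<lambda>i. f i + g i) I \<le> esum f I + esum g I"
    by (auto simp: esum_le_iff sum.distrib intro!: add_mono sum_le_esum)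
  have "sum f F + sum g G \<le> esum (\<lambda>i. f i + g i) I" (is "_ \<le> ?b")
    if "finite F" "F \<subseteq> I" "finite G" "G \<subseteq> I" for F G
  proof -
    have "sum f F + sum g G \<le> sum f (F \<union> G) + sum g (F \<union> G)"
      using that by (intro add_mono sum_mono2) auto
    also have "\<dots> = (\<Sum>i\<in>F \<union> G. f i + g i)" by (simp add: sum.distrib)
    also have "\<dots> \<le> ?b" using that by (intro sum_le_esum) auto
    finally show ?thesis .
  qed
  then have "esum f I + sum g G \<le> ?b" if "finite G" "G \<subseteq> I" for G
    using that by (auto simp: is_lub_le_iff[OF option_add_Scott[OF directed_finite_sums is_lub_esum]])
  then show "esum f I + esum g I \<le> ?b"
    by (auto simp: is_lub_le_iff[OF option_add_Scott_left[OF directed_finite_sums is_lub_esum]])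
qed

lemma esum_sum: "finite F \<Longrightarrow> esum (\<lambda>i. \<Sum>j\<in>F. f i j) I = (\<Sum>j\<in>F. esum (\<lambda>i. f i j) I)"
  by (induction F rule: finite_induct) (auto simp: esum_add intro: esum_neutral)

text \<open>It suffices to bound finite outer sums, and these move inside by
  \<open>esum_sum\<close>. The inequality is its own mirror image, which gives the interchange law
  \<open>esum_swap\<close>.\<close>

lemma esum_swap_le: "esum (\<lambda>i. esum (f i) J) I \<le> esum (\<lambda>j. esum (\<lambda>i. f i j) I) J"
  unfolding esum_le_iff[of _ I]
proof (intro allI impI)
  fix F assume F: "finite F" "F \<subseteq> I"
  have "(\<Sum>i\<in>F. esum (f i) J) = esum (\<lambda>j. \<Sum>i\<in>F. f i j) J"
    using F by (simp add: esum_sum)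
  also have "\<dots> \<le> esum (\<lambda>j. esum (\<lambda>i. f i j) I) J"
    using F by (intro esum_mono sum_le_esum)
  finally show "(\<Sum>i\<in>F. esum (f i) J) \<le> esum (\<lambda>j. esum (\<lambda>i. f i j) I) J" .
qed

lemma esum_swap: "esum (\<lambda>i. esum (f i) J) I = esum (\<lambda>j. esum (\<lambda>i. f i j) I) J"
  by (intro order_antisym esum_swap_le esum_swap_le[of "\<lambda>j i. f i j"])

lemma is_lub_range_sum:
  assumes "finite F" "\<And>i. i \<in> F \<Longrightarrow> ascending (\<lambda>n. g n i)" "\<And>i. i \<in> F \<Longrightarrow> is_lub (range (\<lambda>n. g n i)) (h i)"
  shows "ascending (\<lambda>n. sum (g n) F) \<and>
    is_lub (range (\<lambda>n. sum (g n) F)) (sum h F :: 'u::weight_semiring option)"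
  using assms
proof (induction F rule: finite_induct)
  case empty
  then show ?case by (simp add: ascending_def is_lub_def)
next
  case (insert i F)
  then show ?case
    using is_lub_range_add[of "\<lambda>n. g n i" "h i" "\<lambda>n. sum (g n) F" "sum h F"]
    by (auto simp: ascending_def intro: add_mono)
qed

text \<open>Monotone convergence: finite sums preserve suprema of ascending sequences, and suprema
  commute with suprema.\<close>

lemma is_lub_range_esum:
  assumes asc: "\<And>i. i \<in> I \<Longrightarrow> ascending (\<lambda>n. g n i)"
    and lub: "\<And>i. i \<in> I \<Longrightarrow> is_lub (range (\<lambda>n. g n i)) (h i)"
  shows "is_lub (range (\<lambda>n. esum (g n) I)) (esum h I)"
  unfolding is_lub_def
proof (intro conjI ballI allI impI)
  fix z assume "z \<in> range (\<lambda>n. esum (g n) I)"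
  then show "z \<le> esum h I" using lub by (auto simp: is_lub_def intro!: esum_mono)
next
  fix b assume b: "\<forall>z\<in>range (\<lambda>n. esum (g n) I). z \<le> b"
  show "esum h I \<le> b"
    unfolding esum_le_iff
  proof (intro allI impI)
    fix F assume F: "finite F" "F \<subseteq> I"
    have "is_lub (range (\<lambda>n. sum (g n) F)) (sum h F)"
      using is_lub_range_sum[of F g h] F asc lub by blast
    moreover have "sum (g n) F \<le> b" for n
      using b F by (meson order_trans rangeI sum_le_esum)
    ultimately show "sum h F \<le> b" by (auto simp: is_lub_def)
  qed
qed

section \<open>Sums of weights as totals in the extension\<close>

abbreviation wtotal :: "('i \<Rightarrow> 'u::weight_semiring) \<Rightarrow> 'i set \<Rightarrow> 'u option" where
  "wtotal f I \<equiv> esum (\<lambda>i. Some (f i)) I"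

lemma finite_sums_Some:
  assumes "\<And>F. finite F \<Longrightarrow> F \<subseteq> I \<Longrightarrow> (\<Sum>i\<in>F. Some (f i)) \<noteq> None"
  shows "sum (\<lambda>i. Some (f i)) ` {F. finite F \<and> F \<subseteq> I} =
    Some ` {v. \<exists>F. finite F \<and> F \<subseteq> I \<and> (\<Sum>i\<in>F. Some (f i)) = Some v}"
  using assms by (force simp: image_iff)

text \<open>A total of the form \<open>Some s\<close> bounds every finite partial sum, and only
  \<open>None\<close> lies above \<open>None\<close>, so it encodes that all of them are defined.
  Countability is invisible to \<open>esum\<close> and stays a separate conjunct.\<close>

lemma has_wsum_iff:
  "has_wsum f I s \<longleftrightarrow> countable {i\<in>I. f i \<noteq> 0} \<and> wtotal f I = Some s"
proof -
  have fin: "(\<Sum>i\<in>F. Some (f i)) \<noteq> None" if "wtotal f I = Some s" "finite F" "F \<subseteq> I" for F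
    using sum_le_esum[OF that(2,3), of "\<lambda>i. Some (f i)"] that(1) by (auto elim: le_SomeE)
  have "wtotal f I = Some s \<longleftrightarrow>
    is_lub {v. \<exists>F. finite F \<and> F \<subseteq> I \<and> (\<Sum>i\<in>F. Some (f i)) = Some v} s"
    if "\<And>F. finite F \<Longrightarrow> F \<subseteq> I \<Longrightarrow> (\<Sum>i\<in>F. Some (f i)) \<noteq> None"
  proof -
    have eq: "sum (\<lambda>i. Some (f i)) ` {F. finite F \<and> F \<subseteq> I} =
        Some ` {v. \<exists>F. finite F \<and> F \<subseteq> I \<and> (\<Sum>i\<in>F. Some (f i)) = Some v}"
      by (rule finite_sums_Some[OF that])
    note l = is_lub_esum[of "\<lambda>i. Some (f i)" I, unfolded eq]
    show ?thesis
      unfolding is_lub_Some_iff[symmetric]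
    proof
      assume "wtotal f I = Some s"
      with l show "is_lub (Some ` {v. \<exists>F. finite F \<and> F \<subseteq> I \<and> (\<Sum>i\<in>F. Some (f i)) = Some v}) (Some s)"
        by simp
    qed (rule is_lub_unique[OF l])
  qed
  with fin show ?thesis unfolding has_wsum_def by blast
qed

lemma wsum_eq: "has_wsum f I s \<Longrightarrow> wsum f I = s"
  unfolding wsum_def has_wsum_iff by auto

lemma sum_mult_left:
  "finite F \<Longrightarrow> (\<Sum>i\<in>F. Some (f i)) = Some v \<Longrightarrow> (\<Sum>i\<in>F. Some (c * f i)) = Some (c * v)"
proof (induction F arbitrary: v rule: finite_induct)
  case empty
  then show ?case by (metis Some_0 mult_zero_right option.inject sum.empty)
next
  case (insert i F)
  then obtain w where w: "(\<Sum>i\<in>F. Some (f i)) = Some w"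
    by (cases "\<Sum>i\<in>F. Some (f i)") auto
  with insert show ?case by (simp add: Some_plus_Some padd_distrib_left)
qed

lemma sum_mult_right:
  "finite F \<Longrightarrow> (\<Sum>i\<in>F. Some (f i)) = Some v \<Longrightarrow> (\<Sum>i\<in>F. Some (f i * c)) = Some (v * c)"
proof (induction F arbitrary: v rule: finite_induct)
  case empty
  then show ?case by (metis Some_0 mult_zero_left option.inject sum.empty)
next
  case (insert i F)
  then obtain w where w: "(\<Sum>i\<in>F. Some (f i)) = Some w"
    by (cases "\<Sum>i\<in>F. Some (f i)") auto
  with insert show ?case by (simp add: Some_plus_Some padd_distrib_right)
qed

text \<open>Covers multiplication from either side. As with the distributive laws,
  \<open>hom\<close> speaks of defined sums only, so there is no equation between totals here: the
  total of the images may be defined when the original one is not.\<close>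

lemma wtotal_hom:
  assumes s: "wtotal f I = Some s"
    and hom: "\<And>F v. finite F \<Longrightarrow> (\<Sum>i\<in>F. Some (f i)) = Some v \<Longrightarrow> (\<Sum>i\<in>F. Some (h (f i))) = Some (h v)"
    and Scott: "\<And>D s. directed D \<Longrightarrow> is_lub D s \<Longrightarrow> is_lub (h ` D) (h s)"
  shows "wtotal (\<lambda>i. h (f i)) I = Some (h s)"
proof -
  let ?D = "{v. \<exists>F. finite F \<and> F \<subseteq> I \<and> (\<Sum>i\<in>F. Some (f i)) = Some v}"
  have fin: "(\<Sum>i\<in>F. Some (f i)) \<noteq> None" if "finite F" "F \<subseteq> I" for F
    using sum_le_esum[OF that, of "\<lambda>i. Some (f i)"] s by (auto elim: le_SomeE)
  have eq: "sum (\<lambda>i. Some (f i)) ` {F. finite F \<and> F \<subseteq> I} = Some ` ?D"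
    by (rule finite_sums_Some[OF fin])
  have "directed ?D" "is_lub ?D s"
    using directed_finite_sums[of "\<lambda>i. Some (f i)" I] is_lub_esum[of "\<lambda>i. Some (f i)" I]
    unfolding eq s is_lub_Some_iff directed_Some_iff by auto
  then have "is_lub (Some ` h ` ?D) (Some (h s))"
    unfolding is_lub_Some_iff by (rule Scott)
  moreover have "sum (\<lambda>i. Some (h (f i))) ` {F. finite F \<and> F \<subseteq> I} = Some ` h ` ?D"
  proof (intro equalityI subsetI)
    fix z assume "z \<in> sum (\<lambda>i. Some (h (f i))) ` {F. finite F \<and> F \<subseteq> I}"
    then obtain F where F: "finite F" "F \<subseteq> I" "z = (\<Sum>i\<in>F. Some (h (f i)))" by auto
    then obtain v where "(\<Sum>i\<in>F. Some (f i)) = Some v" using fin by blast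
    with F hom show "z \<in> Some ` h ` ?D" by (auto simp: image_iff)
  next
    fix z assume "z \<in> Some ` h ` ?D"
    then show "z \<in> sum (\<lambda>i. Some (h (f i))) ` {F. finite F \<and> F \<subseteq> I}"
      using hom by (force simp: image_iff)
  qed
  ultimately show ?thesis using is_lub_esum[of "\<lambda>i. Some (h (f i))" I] is_lub_unique by metis
qed

lemma wtotal_mult_left: "wtotal f I = Some s \<Longrightarrow> wtotal (\<lambda>i. c * f i) I = Some (c * s)"
  by (rule wtotal_hom) (auto intro: sum_mult_left mult_Scott_left)

lemma wtotal_mult_right: "wtotal f I = Some s \<Longrightarrow> wtotal (\<lambda>i. f i * c) I = Some (s * c)"
  by (rule wtotal_hom) (auto intro: sum_mult_right mult_Scott_right)

lemma esum_option:
  fixes f :: "'s option \<Rightarrow> 'u::weight_semiring option"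
  shows "esum f UNIV = f None + esum (\<lambda>\<sigma>. f (Some \<sigma>)) UNIV"
proof -
  let ?g = "\<lambda>x :: 's option. if x = None then f None else 0" and ?h = "\<lambda>x. if x = None then 0 else f x"
  have "esum f UNIV = esum (\<lambda>x. ?g x + ?h x) UNIV" by (intro esum_cong) auto
  also have "\<dots> = esum ?g UNIV + esum ?h UNIV" by (rule esum_add)
  also have "esum ?g UNIV = f None" by (subst esum_single[of None]) auto
  also have "esum ?h UNIV = esum ?h (range Some)"
  proof (rule esum_mono_neutral[symmetric])
    fix x :: "'s option" assume "x \<in> UNIV - range Some"
    then show "?h x = 0" by (cases x) simp_all
  qed simp
  also have "\<dots> = esum (\<lambda>\<sigma>. ?h (Some \<sigma>)) UNIV" by (intro esum_reindex) auto
  finally show ?thesis by simp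
qed

section \<open>Weighting functions\<close>

lemma weight_le_mult_top: "a \<le> a * (top::'u::weight_semiring)"
  using weight_mult_left_mono[of 1 top a] by simp

lemma top_mult_top [simp]: "top * top = (top::'u::weight_semiring)"
  using weight_le_mult_top[of "top::'u"] by (simp add: top_unique)

text \<open>Because \<open>top * top = top\<close>, the multiples of \<open>top\<close> are the
  fixed points of right multiplication by \<open>top\<close>. This equational form passes to sums by
  right distributivity and to left multiples by associativity.\<close>

lemma div_weights_iff: "d \<in> div_weights \<longleftrightarrow> d * top = (d::'u::weight_semiring)"
proof
  assume "d \<in> div_weights"
  then show "d * top = d" by (auto simp: div_weights_def mult.assoc)
next
  assume "d * top = d"
  then have "d = d * top" by simp
  then show "d \<in> div_weights" unfolding div_weights_def by (rule image_eqI) simp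
qed

text \<open>The infimum is taken among all weights. Still, \<open>i * top\<close> is again a lower
  bound and thus at most \<open>i\<close>, while the converse inequality holds for every
  weight.\<close>

lemma is_glb_div_weight:
  assumes "is_glb (range d) i" "\<And>n. d n * top = (d n :: 'u::weight_semiring)"
  shows "i * top = i"
proof (rule antisym)
  have "i * top \<le> d n" for n
    using weight_mult_right_mono[of i "d n" top] assms by (simp add: is_glb_def)
  then show "i * top \<le> i" using assms(1) by (simp add: is_glb_def)
qed (rule weight_le_mult_top)

lemma wtotal_mono:
  assumes "wtotal g I = Some s" "\<And>i. i \<in> I \<Longrightarrow> f i \<le> g i"
  obtains t where "wtotal f I = Some t" "t \<le> s"
proof -
  have "wtotal f I \<le> Some s"
    unfolding assms(1)[symmetric] by (intro esum_mono) (simp add: assms)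
  with that show ?thesis by (auto elim: le_SomeE)
qed

text \<open>
  \<open>fusion_cont\<close> is left out, so that the calculus of Kleisli extensions applies to the limit of the
  unrollings of a loop before that property is known for it.
\<close>

definition pre_wfuns :: "('s, 'u::weight_semiring) weighting set" where
  "pre_wfuns = {m. countable (supp m) \<and> wtotal m UNIV \<noteq> None \<and> m None * top = m None}"

lemma pre_wfunsE:
  assumes "m \<in> pre_wfuns"
  obtains s where "countable (supp m)" "wtotal m UNIV = Some s" "m None * top = m None"
  using assms by (auto simp: pre_wfuns_def)

lemma wtotal_supp: "wtotal m (supp m) = wtotal m UNIV"
  by (intro esum_mono_neutral) (auto simp: supp_def)

lemma wfuns_iff: "m \<in> wfuns \<longleftrightarrow> m \<in> pre_wfuns \<and> fusion_cont m"
proof -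
  have "wsummable m (supp m) \<longleftrightarrow> countable (supp m) \<and> wtotal m UNIV \<noteq> None"
    unfolding wsummable_def has_wsum_iff wtotal_supp by (auto simp: supp_def)
  then show ?thesis by (auto simp: wfuns_def pre_wfuns_def div_weights_iff)
qed

lemma wfuns_pre: "m \<in> wfuns \<Longrightarrow> m \<in> pre_wfuns"
  by (simp add: wfuns_iff)

lemma mass_eq:
  assumes "m \<in> pre_wfuns"
  shows "wtotal m UNIV = Some (mass m)"
proof -
  obtain s where s: "countable (supp m)" "wtotal m UNIV = Some s" using assms by (rule pre_wfunsE)
  then have "has_wsum m (supp m) s"
    unfolding has_wsum_iff wtotal_supp by (auto simp: supp_def)
  then show ?thesis using s by (simp add: mass_def wsum_eq)
qed

section \<open>Kleisli extension and its linearity\<close>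

lemma eta_simps [simp]: "eta x x = 1" "x \<noteq> y \<Longrightarrow> eta x y = 0"
  by (simp_all add: eta_def)

text \<open>
  With the row \<open>eta None\<close> for \<open>\<natural>\<close>, Kleisli extension is a single sum over all of
  \<open>\<Sigma>\<^sub>\<natural>\<close>. Such sums are defined for every \<open>f\<close>, as they are below \<open>mass m * top\<close>.
\<close>

definition lift_kernel :: "('s \<Rightarrow> ('s, 'u::weight_semiring) weighting) \<Rightarrow> 's option \<Rightarrow> ('s, 'u) weighting" where
  "lift_kernel f x = (case x of None \<Rightarrow> eta None | Some \<sigma> \<Rightarrow> f \<sigma>)"

lemma lift_kernel_simps [simp]: "lift_kernel f None = eta None" "lift_kernel f (Some \<sigma>) = f \<sigma>"
  by (simp_all add: lift_kernel_def)

lemma kleisli_eq: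
  assumes "m \<in> pre_wfuns"
  shows "wtotal (\<lambda>x. m x * lift_kernel f x y) UNIV = Some (kleisli f m y)"
proof -
  obtain s where m: "countable (supp m)" "wtotal m UNIV = Some s" using assms by (rule pre_wfunsE)
  obtain t where t: "wtotal (\<lambda>x. m x * lift_kernel f x y) UNIV = Some t"
    by (rule wtotal_mono[OF wtotal_mult_right[OF m(2), of top],
          where f = "\<lambda>x. m x * lift_kernel f x y"]) (auto intro: weight_mult_left_mono)
  let ?S = "{\<sigma>. Some \<sigma> \<in> supp m}"
  have split: "Some t = Some (m None * eta None y) + wtotal (\<lambda>\<sigma>. m (Some \<sigma>) * f \<sigma> y) UNIV"
    using t by (simp add: esum_option)
  then obtain w where w: "wtotal (\<lambda>\<sigma>. m (Some \<sigma>) * f \<sigma> y) UNIV = Some w"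
    by (cases "wtotal (\<lambda>\<sigma>. m (Some \<sigma>) * f \<sigma> y) UNIV") auto
  \<comment> \<open>\<open>has_wsum\<close> includes countability, so the value of
    \<open>wsum\<close> is determined only once this is known.\<close>
  have "countable ?S"
    by (rule countable_subset[OF _ countable_image[OF m(1), of the]]) force
  then have "countable {\<sigma>\<in>?S. m (Some \<sigma>) * f \<sigma> y \<noteq> 0}" by (rule countable_subset[rotated]) auto
  moreover have "wtotal (\<lambda>\<sigma>. m (Some \<sigma>) * f \<sigma> y) ?S = Some w"
    unfolding w[symmetric] by (intro esum_mono_neutral) (auto simp: supp_def)
  ultimately have "wsum (\<lambda>\<sigma>. m (Some \<sigma>) * f \<sigma> y) ?S = w"
    by (intro wsum_eq) (simp add: has_wsum_iff)
  then have "kleisli f m y = the (Some w + Some (m None * eta None y))"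
    by (simp add: kleisli_def wplus_def lscale_def)
  also have "\<dots> = t" using split w by (metis add.commute option.sel)
  finally show ?thesis using t by simp
qed

lemma kleisli_cong: "(\<And>\<sigma>. f \<sigma> y = g \<sigma> y) \<Longrightarrow> kleisli f m y = kleisli g m y"
  by (simp add: kleisli_def wplus_def)

lemma wtotal_eta: "wtotal (\<lambda>y. eta x y * a y) UNIV = Some (a x)"
  by (subst esum_single[of x]) auto

lemma supp_kleisli:
  assumes "m \<in> pre_wfuns"
  shows "supp (kleisli f m) \<subseteq> (\<Union>x\<in>supp m. supp (lift_kernel f x))"
proof
  fix y assume y: "y \<in> supp (kleisli f m)"
  show "y \<in> (\<Union>x\<in>supp m. supp (lift_kernel f x))"
  proof (rule ccontr)
    assume "\<not> ?thesis"
    then have "m x * lift_kernel f x y = 0" for x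
      by (cases "m x = 0") (auto simp: supp_def)
    then have "wtotal (\<lambda>x. m x * lift_kernel f x y) UNIV = 0"
      by (intro esum_neutral) auto
    then show False using y by (simp add: kleisli_eq[OF assms] supp_def)
  qed
qed

text \<open>After interchanging sums, the total is the sum of \<open>m x\<close> times the mass of
  row \<open>x\<close>. Row masses are at most \<open>top\<close>, so it is bounded by the mass of
  \<open>m\<close> times \<open>top\<close>. At natural, every summand absorbs \<open>top\<close> on
  the right.\<close>

lemma kleisli_pre_wfuns:
  fixes m :: "('s, 'u::weight_semiring) weighting"
  assumes m: "m \<in> pre_wfuns" and f: "\<And>\<sigma>. f \<sigma> \<in> pre_wfuns"
  shows "kleisli f m \<in> pre_wfuns"
proof -
  obtain s where s: "countable (supp m)" "wtotal m UNIV = Some s" "m None * top = m None"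
    using m by (rule pre_wfunsE)
  have "countable (supp (lift_kernel f x))" for x
  proof (cases x)
    case None
    have "supp (eta None :: ('s, 'u) weighting) \<subseteq> {None}" by (auto simp: supp_def eta_def)
    then have "countable (supp (eta None :: ('s, 'u) weighting))" by (rule countable_subset) simp
    with None show ?thesis by simp
  qed (use f in \<open>auto simp: pre_wfuns_def\<close>)
  then have "countable (supp (kleisli f m))"
    using supp_kleisli[OF m] s(1) by (meson countable_UN countable_subset)
  moreover have "wtotal (kleisli f m) UNIV \<noteq> None"
  proof -
    have "wtotal (lift_kernel f x) UNIV \<noteq> None" for x
    proof (cases x)
      case None
      then show ?thesis using wtotal_eta[of "None :: 's option" "\<lambda>_. 1 :: 'u"] by simp
    qed (use f in \<open>auto simp: pre_wfuns_def\<close>)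
    then obtain t where t: "\<And>x. wtotal (lift_kernel f x) UNIV = Some (t x)"
      unfolding not_None_eq by metis
    have "wtotal (kleisli f m) UNIV = esum (\<lambda>y. wtotal (\<lambda>x. m x * lift_kernel f x y) UNIV) UNIV"
      by (simp add: kleisli_eq[OF m])
    also have "\<dots> = esum (\<lambda>x. wtotal (\<lambda>y. m x * lift_kernel f x y) UNIV) UNIV"
      by (rule esum_swap)
    also have "\<dots> = wtotal (\<lambda>x. m x * t x) UNIV"
      by (simp add: wtotal_mult_left[OF t])
    moreover obtain v where "wtotal (\<lambda>x. m x * t x) UNIV = Some v"
      by (rule wtotal_mono[OF wtotal_mult_right[OF s(2), of top], where f = "\<lambda>x. m x * t x"])
        (auto intro: weight_mult_left_mono)
    ultimately show ?thesis by simp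
  qed
  moreover have "kleisli f m None * top = kleisli f m None"
  proof -
    have "m x * lift_kernel f x None * top = m x * lift_kernel f x None" for x
      using s(3) f by (cases x) (auto simp: pre_wfuns_def mult.assoc)
    then show ?thesis
      using wtotal_mult_right[OF kleisli_eq[OF m, of f None], of top] kleisli_eq[OF m, of f None]
      by simp
  qed
  ultimately show ?thesis by (simp add: pre_wfuns_def)
qed

text \<open>Both sides are the same double sum of triple products. Distributivity applies on either
  side because every inner sum is defined: by \<open>kleisli_eq\<close>, or by
  \<open>wtotal_eta\<close> for the row of natural.\<close>

lemma kleisli_assoc:
  assumes m: "m \<in> pre_wfuns" and f: "\<And>\<sigma>. f \<sigma> \<in> pre_wfuns"
  shows "kleisli g (kleisli f m) = kleisli (\<lambda>\<sigma>. kleisli g (f \<sigma>)) m"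
proof
  fix y
  have ker: "wtotal (\<lambda>z. lift_kernel f x z * lift_kernel g z y) UNIV =
      Some (lift_kernel (\<lambda>\<sigma>. kleisli g (f \<sigma>)) x y)" for x
    by (cases x) (simp_all add: wtotal_eta kleisli_eq[OF f])
  have "Some (kleisli g (kleisli f m) y) =
      wtotal (\<lambda>z. kleisli f m z * lift_kernel g z y) UNIV"
    by (rule kleisli_eq[OF kleisli_pre_wfuns[OF m f], symmetric])
  also have "\<dots> = esum (\<lambda>z. wtotal (\<lambda>x. m x * lift_kernel f x z * lift_kernel g z y) UNIV) UNIV"
    by (simp add: wtotal_mult_right[OF kleisli_eq[OF m]])
  also have "\<dots> = esum (\<lambda>x. wtotal (\<lambda>z. m x * (lift_kernel f x z * lift_kernel g z y)) UNIV) UNIV"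
    by (subst esum_swap) (simp add: mult.assoc)
  also have "\<dots> = Some (kleisli (\<lambda>\<sigma>. kleisli g (f \<sigma>)) m y)"
    by (simp add: wtotal_mult_left[OF ker] kleisli_eq[OF m])
  finally show "kleisli g (kleisli f m) y = kleisli (\<lambda>\<sigma>. kleisli g (f \<sigma>)) m y" by simp
qed

lemma kleisli_mono:
  assumes "m \<in> pre_wfuns" "\<And>\<sigma>. f \<sigma> y \<le> g \<sigma> y"
  shows "kleisli f m y \<le> kleisli g m y"
proof -
  have le: "lift_kernel f x y \<le> lift_kernel g x y" for x using assms(2) by (cases x) auto
  have "Some (kleisli f m y) \<le> Some (kleisli g m y)"
    unfolding kleisli_eq[OF assms(1), symmetric]
    by (intro esum_mono) (simp add: le weight_mult_left_mono)
  then show ?thesis by simp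
qed

lemma kleisli_lub:
  assumes m: "m \<in> pre_wfuns" and asc: "\<And>\<sigma>. ascending (\<lambda>n. f n \<sigma> y)"
    and lub: "\<And>\<sigma>. is_lub (range (\<lambda>n. f n \<sigma> y)) (g \<sigma> y)"
  shows "is_lub (range (\<lambda>n. kleisli (f n) m y)) (kleisli g m y)"
proof -
  have "ascending (\<lambda>n. lift_kernel (f n) x y) \<and>
      is_lub (range (\<lambda>n. lift_kernel (f n) x y)) (lift_kernel g x y)" for x
    using asc lub by (cases x) (auto simp: ascending_def is_lub_def)
  then have "ascending (\<lambda>n. Some (m x * lift_kernel (f n) x y)) \<and>
      is_lub (range (\<lambda>n. Some (m x * lift_kernel (f n) x y))) (Some (m x * lift_kernel g x y))" for x
    using mult_Scott_left[OF directed_range_ascending, of "\<lambda>n. lift_kernel (f n) x y"]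
    unfolding is_lub_range_Some_iff by (auto simp: ascending_def weight_mult_left_mono image_image)
  then have "is_lub (range (\<lambda>n. wtotal (\<lambda>x. m x * lift_kernel (f n) x y) UNIV))
      (wtotal (\<lambda>x. m x * lift_kernel g x y) UNIV)"
    by (intro is_lub_range_esum) auto
  then show ?thesis by (simp add: kleisli_eq[OF m] is_lub_range_Some_iff)
qed

lemma kleisli_wsum:
  assumes m: "m \<in> pre_wfuns" and ms: "\<And>t. t \<in> T \<Longrightarrow> ms t \<in> pre_wfuns"
    and sum: "\<And>x. has_wsum (\<lambda>t. ms t x) T (m x)"
  shows "has_wsum (\<lambda>t. kleisli f (ms t) y) T (kleisli f m y)"
  unfolding has_wsum_iff
proof
  have total: "wtotal (\<lambda>t. ms t x) T = Some (m x)" for x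
    using sum by (simp add: has_wsum_iff)
  have ms_le: "ms t x \<le> m x" if "t \<in> T" for t x
    using le_esum[OF that, of "\<lambda>t. Some (ms t x)"] by (simp add: total)
  \<comment> \<open>A nonzero value at \<open>y\<close> requires a point \<open>x\<close> where
    \<open>ms t\<close> is nonzero, and there \<open>m\<close> is nonzero too. Each of the countably
    many such \<open>x\<close> occurs for countably many \<open>t\<close>.\<close>
  have "{t\<in>T. kleisli f (ms t) y \<noteq> 0} \<subseteq> (\<Union>x\<in>supp m. {t\<in>T. ms t x \<noteq> 0})"
  proof
    fix t assume "t \<in> {t\<in>T. kleisli f (ms t) y \<noteq> 0}"
    then have t: "t \<in> T" "y \<in> supp (kleisli f (ms t))" by (auto simp: supp_def)
    then obtain x where x: "x \<in> supp (ms t)" using supp_kleisli[OF ms] by blast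
    with ms_le[OF t(1), of x] have "x \<in> supp m" by (auto simp: supp_def)
    with t x show "t \<in> (\<Union>x\<in>supp m. {t\<in>T. ms t x \<noteq> 0})" by (auto simp: supp_def)
  qed
  moreover have "countable (\<Union>x\<in>supp m. {t\<in>T. ms t x \<noteq> 0})"
    using m sum by (auto simp: pre_wfuns_def has_wsum_iff)
  ultimately show "countable {t\<in>T. kleisli f (ms t) y \<noteq> 0}" by (rule countable_subset)
  have "wtotal (\<lambda>t. kleisli f (ms t) y) T =
      esum (\<lambda>t. wtotal (\<lambda>x. ms t x * lift_kernel f x y) UNIV) T"
    by (intro esum_cong) (simp add: kleisli_eq[OF ms])
  also have "\<dots> = esum (\<lambda>x. wtotal (\<lambda>t. ms t x * lift_kernel f x y) T) UNIV"
    by (rule esum_swap)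
  also have "\<dots> = Some (kleisli f m y)"
    by (simp add: wtotal_mult_right[OF total] kleisli_eq[OF m])
  finally show "wtotal (\<lambda>t. kleisli f (ms t) y) T = Some (kleisli f m y)" .
qed

lemma kleisli_add:
  assumes "m \<in> pre_wfuns" "m1 \<in> pre_wfuns" "m2 \<in> pre_wfuns"
    and sum: "\<And>x. Some (m1 x) + Some (m2 x) = Some (m x)"
  shows "Some (kleisli f m1 y) + Some (kleisli f m2 y) = Some (kleisli f m y)"
  unfolding assms(1-3)[THEN kleisli_eq, symmetric] esum_add[symmetric]
proof (rule esum_cong)
  fix x
  have "padd (m1 x * lift_kernel f x y) (m2 x * lift_kernel f x y) = Some (m x * lift_kernel f x y)"
    using sum by (intro padd_distrib_right) (simp add: Some_plus_Some)
  then show "Some (m1 x * lift_kernel f x y) + Some (m2 x * lift_kernel f x y) =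
      Some (m x * lift_kernel f x y)"
    by (simp add: Some_plus_Some)
qed

text \<open>The row of natural is \<open>eta None\<close> in all three extensions, so at natural the
  left side would count \<open>m None\<close> twice; \<open>none\<close> excludes this. It is here
  that the premise \<open>entails_true\<close> of the rule for \<open>Plus\<close> enters.\<close>

lemma kleisli_add_kernel:
  assumes m: "m \<in> pre_wfuns" and none: "m None = 0 \<or> y \<noteq> None"
    and sum: "\<And>\<sigma>. Some (f1 \<sigma> y) + Some (f2 \<sigma> y) = Some (f \<sigma> y)"
  shows "Some (kleisli f1 m y) + Some (kleisli f2 m y) = Some (kleisli f m y)"
  unfolding kleisli_eq[OF m, symmetric] esum_add[symmetric]
proof (rule esum_cong)
  fix x
  show "Some (m x * lift_kernel f1 x y) + Some (m x * lift_kernel f2 x y) =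
      Some (m x * lift_kernel f x y)"
  proof (cases x)
    case None
    have "m None * eta None y = 0" using none by (cases y) auto
    with None show ?thesis by simp
  next
    case (Some \<sigma>)
    then show ?thesis using sum[of \<sigma>] by (simp add: Some_plus_Some padd_distrib_left)
  qed
qed

section \<open>Scaled weightings and point masses\<close>

lemma lscale_pre_wfuns: "m \<in> pre_wfuns \<Longrightarrow> lscale u m \<in> pre_wfuns"
  by (auto simp: pre_wfuns_def lscale_def supp_def mult.assoc wtotal_mult_left
      elim: countable_subset[rotated])

lemma kleisli_lscale:
  assumes "m \<in> pre_wfuns"
  shows "kleisli f (lscale u m) = lscale u (kleisli f m)"
proof
  fix y
  show "kleisli f (lscale u m) y = lscale u (kleisli f m) y"
    using kleisli_eq[OF lscale_pre_wfuns[OF assms], of u f y]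
      wtotal_mult_left[OF kleisli_eq[OF assms], of u f y]
    by (simp add: lscale_def mult.assoc)
qed

lemma supp_lscale_eta: "supp (lscale u (eta x)) \<subseteq> {x}"
  by (auto simp: supp_def lscale_def eta_def)

lemma lscale_eta_pre_wfuns:
  assumes "x = None \<Longrightarrow> d * top = d"
  shows "lscale d (eta x) \<in> pre_wfuns"
proof -
  have "wtotal (lscale d (eta x)) UNIV = Some d"
    using wtotal_mult_left[OF wtotal_eta[of x "\<lambda>_. 1"], of d] by (simp add: lscale_def)
  moreover have "countable (supp (lscale d (eta x)))"
    by (rule countable_subset[OF supp_lscale_eta]) simp
  ultimately show ?thesis
    using assms by (cases x) (auto simp: pre_wfuns_def lscale_def)
qed

lemma eta_pre_wfuns: "eta (Some \<sigma>) \<in> pre_wfuns"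
  using lscale_eta_pre_wfuns[of "Some \<sigma>" 1] by (simp add: lscale_def)

lemma kleisli_lscale_eta:
  assumes "x = None \<Longrightarrow> d * top = d"
  shows "kleisli f (lscale d (eta x)) = lscale d (lift_kernel f x)"
proof
  fix y
  show "kleisli f (lscale d (eta x)) y = lscale d (lift_kernel f x) y"
    using kleisli_eq[OF lscale_eta_pre_wfuns[OF assms, where x = x], of f y]
      wtotal_mult_left[OF wtotal_eta, of d x "\<lambda>x. lift_kernel f x y"]
    by (simp add: lscale_def mult.assoc)
qed

lemma kleisli_eta: "kleisli f (eta (Some \<sigma>)) = f \<sigma>"
  using kleisli_lscale_eta[of "Some \<sigma>" 1 f] by (simp add: lscale_def)

text \<open>The kernel is diagonal, so a single summand survives. This serves both
  \<open>Assume\<close> and the exit weights of a loop.\<close>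

lemma kleisli_rscale_kernel:
  assumes m: "m \<in> pre_wfuns" and none: "m None = 0 \<or> y \<noteq> None"
  shows "kleisli (\<lambda>\<sigma>. lscale (w \<sigma>) (eta (Some \<sigma>))) m y = (case y of None \<Rightarrow> 0 | Some \<sigma> \<Rightarrow> m y * w \<sigma>)"
proof -
  let ?k = "lift_kernel (\<lambda>\<sigma>. lscale (w \<sigma>) (eta (Some \<sigma>)))"
  have zero: "m x * ?k x y = 0" if "x \<noteq> y" for x
    using that by (cases x) (auto simp: lscale_def)
  have "Some (kleisli (\<lambda>\<sigma>. lscale (w \<sigma>) (eta (Some \<sigma>))) m y) = Some (m y * ?k y y)"
    unfolding kleisli_eq[OF m, symmetric] by (subst esum_single[of y]) (auto simp: zero)
  then show ?thesis using none by (cases y) (auto simp: lscale_def)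
qed

lemma kleisli_eta_kernel:
  assumes m: "m \<in> pre_wfuns"
  shows "kleisli (\<lambda>\<sigma>. eta (Some \<sigma>)) m = m"
proof
  fix y
  let ?k = "lift_kernel (\<lambda>\<sigma>. eta (Some \<sigma>))"
  have k: "?k x = eta x" for x by (cases x) auto
  have "Some (kleisli (\<lambda>\<sigma>. eta (Some \<sigma>)) m y) = Some (m y)"
    unfolding kleisli_eq[OF m, symmetric] k by (subst esum_single[of y]) auto
  then show "kleisli (\<lambda>\<sigma>. eta (Some \<sigma>)) m y = m y" by simp
qed

text \<open>The total weight of divergence if running on from \<open>\<sigma>\<close> diverges with weight \<open>d \<sigma>\<close>.\<close>

definition divw :: "('s, 'u::weight_semiring) weighting \<Rightarrow> ('s \<Rightarrow> 'u) \<Rightarrow> 'u" where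
  "divw m d = kleisli (\<lambda>\<sigma>. lscale (d \<sigma>) (eta None)) m None"

text \<open>At natural only the entries of the rows at natural count, so \<open>fusion_cont\<close>,
  which speaks of kernels concentrated there, controls arbitrary kernels.\<close>

lemma kleisli_None: "kleisli f m None = divw m (\<lambda>\<sigma>. f \<sigma> None)"
  unfolding divw_def by (rule kleisli_cong) (simp add: lscale_def)

lemma divw_mono: "m \<in> pre_wfuns \<Longrightarrow> (\<And>\<sigma>. d \<sigma> \<le> d' \<sigma>) \<Longrightarrow> divw m d \<le> divw m d'"
  unfolding divw_def by (rule kleisli_mono) (simp_all add: lscale_def)

lemma divw_kleisli:
  assumes "m \<in> pre_wfuns" "\<And>\<sigma>. f \<sigma> \<in> pre_wfuns"
  shows "divw (kleisli f m) d = divw m (\<lambda>\<sigma>. divw (f \<sigma>) d)"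
  unfolding divw_def[of "kleisli f m"] kleisli_assoc[OF assms] kleisli_None divw_def[symmetric]
  by (simp add: lscale_def)

lemma divw_div_weight:
  assumes "m \<in> pre_wfuns" "\<And>\<sigma>. d \<sigma> * top = d \<sigma>"
  shows "divw m d * top = divw m d"
  using kleisli_pre_wfuns[OF assms(1) lscale_eta_pre_wfuns[of None, OF assms(2)]]
  unfolding divw_def by (simp add: pre_wfuns_def)

lemma divw_lscale: "m \<in> pre_wfuns \<Longrightarrow> divw (lscale u m) d = u * divw m d"
  by (simp add: divw_def kleisli_lscale) (simp add: lscale_def)

section \<open>Closure of weightings under Kleisli extension and scaling\<close>

lemma fusion_contI:
  assumes "\<And>d i. (\<And>n \<sigma>. d n \<sigma> * top = d n \<sigma>) \<Longrightarrow> (\<And>\<sigma>. descending (\<lambda>n. d n \<sigma>)) \<Longrightarrow>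
    (\<And>\<sigma>. is_glb (range (\<lambda>n. d n \<sigma>)) (i \<sigma>)) \<Longrightarrow> is_glb (range (\<lambda>n. divw m (d n))) (divw m i)"
  shows "fusion_cont m"
  unfolding fusion_cont_def divw_def[symmetric]
  using assms by (auto simp: image_subset_iff div_weights_iff)

lemma fusion_contD:
  assumes "fusion_cont m" "\<And>n \<sigma>. d n \<sigma> * top = d n \<sigma>" "\<And>\<sigma>. descending (\<lambda>n. d n \<sigma>)"
    "\<And>\<sigma>. is_glb (range (\<lambda>n. d n \<sigma>)) (i \<sigma>)"
  shows "is_glb (range (\<lambda>n. divw m (d n))) (divw m i)"
  using assms unfolding fusion_cont_def divw_def[symmetric]
  by (auto simp: image_subset_iff div_weights_iff)

text \<open>\<open>fusion_cont\<close> is used twice: for each row \<open>f \<sigma>\<close> with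
  \<open>d\<close>, and for \<open>m\<close> with the sequence
  \<open>divw (f \<sigma>) (d n)\<close>, which is again descending and consists of divergence
  weights.\<close>

lemma kleisli_wfuns:
  assumes m: "m \<in> wfuns" and f: "\<And>\<sigma>. f \<sigma> \<in> wfuns"
  shows "kleisli f m \<in> wfuns"
proof -
  note pre = wfuns_pre[OF m] wfuns_pre[OF f]
  have "fusion_cont (kleisli f m)"
  proof (rule fusion_contI)
    fix d :: "nat \<Rightarrow> 'a \<Rightarrow> 'b" and i
    assume d: "\<And>n \<sigma>. d n \<sigma> * top = d n \<sigma>" "\<And>\<sigma>. descending (\<lambda>n. d n \<sigma>)"
      "\<And>\<sigma>. is_glb (range (\<lambda>n. d n \<sigma>)) (i \<sigma>)"
    have "is_glb (range (\<lambda>n. divw (f \<sigma>) (d n))) (divw (f \<sigma>) i)" for \<sigma>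
      using f[of \<sigma>] d by (intro fusion_contD) (auto simp: wfuns_iff)
    moreover have "descending (\<lambda>n. divw (f \<sigma>) (d n))" for \<sigma>
      using d(2) pre(2) by (auto simp: descending_def intro: divw_mono)
    ultimately show "is_glb (range (\<lambda>n. divw (kleisli f m) (d n))) (divw (kleisli f m) i)"
      unfolding divw_kleisli[OF pre] using m d(1) pre(2)
      by (intro fusion_contD[where d = "\<lambda>n \<sigma>. divw (f \<sigma>) (d n)"]) (auto simp: wfuns_iff divw_div_weight)
  qed
  with kleisli_pre_wfuns[OF pre] show ?thesis by (simp add: wfuns_iff)
qed

lemma divw_lscale_eta: "divw (lscale u (eta (Some \<sigma>))) d = u * d \<sigma>"
  unfolding divw_def by (subst kleisli_lscale_eta) (auto simp: lscale_def)

lemma lscale_wfuns: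
  fixes m :: "('s, 'u::fusion_semiring) weighting"
  assumes m: "m \<in> wfuns"
  shows "lscale u m \<in> wfuns"
proof -
  note pre = wfuns_pre[OF m]
  have "fusion_cont (lscale u m)"
  proof (rule fusion_contI)
    fix d :: "nat \<Rightarrow> 's \<Rightarrow> 'u" and i
    assume d: "\<And>n \<sigma>. d n \<sigma> * top = d n \<sigma>" "\<And>\<sigma>. descending (\<lambda>n. d n \<sigma>)"
      "\<And>\<sigma>. is_glb (range (\<lambda>n. d n \<sigma>)) (i \<sigma>)"
    have "is_glb (range (\<lambda>n. divw m (d n))) (divw m i)"
      using m d by (intro fusion_contD) (auto simp: wfuns_iff)
    moreover have "descending (\<lambda>n. divw m (d n))"
      using d(2) pre by (auto simp: descending_def intro: divw_mono)
    ultimately show "is_glb (range (\<lambda>n. divw (lscale u m) (d n))) (divw (lscale u m) i)"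
      unfolding divw_lscale[OF pre]
      by (intro div_mult_inf) (auto simp: div_weights_iff divw_div_weight[OF pre d(1)])
  qed
  with lscale_pre_wfuns[OF pre] show ?thesis by (simp add: wfuns_iff)
qed

lemma eta_wfuns: "eta (Some \<sigma>) \<in> wfuns"
proof -
  have divw: "divw (eta (Some \<sigma>)) d = d \<sigma>" for d :: "_ \<Rightarrow> 'u::weight_semiring"
    unfolding divw_def kleisli_eta by (simp add: lscale_def)
  have "fusion_cont (eta (Some \<sigma>))"
    by (rule fusion_contI) (simp add: divw)
  then show ?thesis by (simp add: wfuns_iff eta_pre_wfuns)
qed

lemma lscale_eta_None_wfuns:
  assumes "u * top = (u :: 'u::weight_semiring)"
  shows "lscale u (eta (None :: 's option)) \<in> wfuns"
proof -
  have divw: "divw (lscale u (eta None)) d = u" for d :: "'s \<Rightarrow> 'u"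
    unfolding divw_def using assms by (subst kleisli_lscale_eta) (auto simp: lscale_def)
  have "fusion_cont (lscale u (eta (None :: 's option)))"
    by (rule fusion_contI) (simp add: divw is_glb_def)
  then show ?thesis
    using assms by (simp add: wfuns_iff lscale_eta_pre_wfuns)
qed

section \<open>Loops\<close>

lemma is_lub_not_None:
  fixes D :: "'u::weight_semiring option set"
  assumes "directed D" "is_lub D s" "None \<notin> D"
  shows "s \<noteq> None"
proof -
  obtain D' where D': "D = Some ` D'" using assms(3) by (cases D rule: option_set_cases) auto
  with assms(1) obtain s' where "is_lub D' s'" using directed_sup directed_Some_iff by blast
  then have "is_lub D (Some s')" by (simp add: D' is_lub_Some_iff)
  with assms(2) have "s = Some s'" by (rule is_lub_unique)
  then show ?thesis by simp
qed

lemma is_lub_range_Suc: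
  assumes "ascending (x :: nat \<Rightarrow> 'a::order)" "is_lub (range x) s"
  shows "is_lub (range (\<lambda>n. x (Suc n))) s"
  using assms unfolding is_lub_def ascending_def by (simp, meson order_trans)

lemma is_glb_range_Suc:
  assumes "descending (x :: nat \<Rightarrow> 'a::order)" "is_glb (range x) s"
  shows "is_glb (range (\<lambda>n. x (Suc n))) s"
  using assms unfolding is_glb_def descending_def by (simp, meson order_trans)

text \<open>Initial segments are cofinal among the finite sets of numbers.\<close>

lemma is_lub_esum_nat: "is_lub (range (\<lambda>n. sum f {..<n})) (esum f (UNIV :: nat set))"
  unfolding is_lub_def
proof (intro conjI ballI allI impI)
  fix x assume "x \<in> range (\<lambda>n. sum f {..<n})"
  then show "x \<le> esum f UNIV" by (auto intro: sum_le_esum)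
next
  fix b assume b: "\<forall>x\<in>range (\<lambda>n. sum f {..<n}). x \<le> b"
  show "esum f UNIV \<le> b"
    unfolding esum_le_iff
  proof (intro allI impI)
    fix F :: "nat set" assume "finite F"
    then obtain n where n: "F \<subseteq> {..<n}" by (meson finite_nat_iff_bounded)
    then have "sum f F \<le> sum f {..<n}" by (intro sum_mono2) auto
    also have "\<dots> \<le> b" using b by auto
    finally show "sum f F \<le> b" .
  qed
qed

text \<open>Along the unrollings of a loop the first summand decreases and the second increases,
  which is the situation of \<open>div_padd_inf\<close>.\<close>

lemma divw_split:
  assumes "m \<in> pre_wfuns"
  shows "Some (divw m d) = Some (m None) + wtotal (\<lambda>\<sigma>. m (Some \<sigma>) * d \<sigma>) UNIV"
  unfolding divw_def kleisli_eq[OF assms, symmetric] esum_option by (simp add: lscale_def)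

locale loop =
  fixes c :: "'s \<Rightarrow> ('s, 'u::fusion_semiring) weighting" and e1 e2 :: "('s, 'u) guard"
  assumes body_wfuns: "c \<sigma> \<in> wfuns"
    and step_defined: "(\<And>\<sigma>. f \<sigma> \<in> wfuns) \<Longrightarrow>
      wplus_defined (lscale (gval e1 \<sigma>) (kleisli f (c \<sigma>))) (lscale (gval e2 \<sigma>) (eta (Some \<sigma>)))"
begin

abbreviation op :: "('s \<Rightarrow> ('s, 'u) weighting) \<Rightarrow> 's \<Rightarrow> ('s, 'u) weighting" where
  "op \<equiv> loop_op c e1 e2"

text \<open>With the guard folded in, this is the denotation of \<open>Seq (Assume e1) C\<close> if
  \<open>c\<close> is that of \<open>C\<close>, hence of the command in the premise of the loop
  rule.\<close>

definition body :: "'s \<Rightarrow> ('s, 'u) weighting" where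
  "body \<sigma> = lscale (gval e1 \<sigma>) (c \<sigma>)"

text \<open>The starting point is least in the fusion order: zero on states and \<open>top\<close>
  at natural.\<close>

definition iter :: "nat \<Rightarrow> 's \<Rightarrow> ('s, 'u) weighting" where
  "iter n = (op ^^ n) (\<lambda>\<sigma>. lscale top (eta None))"

definition limit :: "'s \<Rightarrow> ('s, 'u) weighting" where
  "limit \<sigma> x = (if x = None then SOME i. is_glb (range (\<lambda>n. iter n \<sigma> x)) i
     else SOME s. is_lub (range (\<lambda>n. iter n \<sigma> x)) s)"

text \<open>Unlike \<open>h = op f\<close>, this includes that all sums involved are defined.\<close>

definition steps :: "('s \<Rightarrow> ('s, 'u) weighting) \<Rightarrow> ('s \<Rightarrow> ('s, 'u) weighting) \<Rightarrow> bool" where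
  "steps f h \<longleftrightarrow> (\<forall>\<sigma> x. Some (kleisli f (body \<sigma>) x) + Some (gval e2 \<sigma> * eta (Some \<sigma>) x) = Some (h \<sigma> x))"

lemma body_wfuns': "body \<sigma> \<in> wfuns"
  unfolding body_def by (intro lscale_wfuns body_wfuns)

lemmas body_pre = wfuns_pre[OF body_wfuns']

lemma kleisli_body: "lscale (gval e1 \<sigma>) (kleisli f (c \<sigma>)) = kleisli f (body \<sigma>)"
  by (simp add: body_def kleisli_lscale[OF wfuns_pre[OF body_wfuns]])

lemma op_eq: "op f \<sigma> = wplus (kleisli f (body \<sigma>)) (lscale (gval e2 \<sigma>) (eta (Some \<sigma>)))"
  by (simp add: loop_op_def kleisli_body)

lemma op_wfuns: "(\<And>\<sigma>. f \<sigma> \<in> wfuns) \<Longrightarrow> op f \<sigma> \<in> wfuns"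
  using step_defined unfolding op_eq kleisli_body by (simp add: wplus_defined_def)

lemma steps_op: "(\<And>\<sigma>. f \<sigma> \<in> wfuns) \<Longrightarrow> steps f (op f)"
  using step_defined unfolding op_eq kleisli_body steps_def
  by (auto simp: wplus_defined_def wplus_def lscale_def)

lemma steps_imp_op: "steps f h \<Longrightarrow> op f = h"
  by (intro ext) (simp add: steps_def op_eq wplus_def lscale_def)

text \<open>Stated for a single \<open>x\<close>, so that it can be applied in opposite directions
  on states and at natural, as the fusion order demands.\<close>

lemma steps_mono:
  assumes "steps f h" "steps f' h'" "\<And>\<sigma>. f \<sigma> x \<le> f' \<sigma> x"
  shows "h \<sigma> x \<le> h' \<sigma> x"
proof -
  have "Some (kleisli f (body \<sigma>) x) + Some (gval e2 \<sigma> * eta (Some \<sigma>) x) \<le>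
      Some (kleisli f' (body \<sigma>) x) + Some (gval e2 \<sigma> * eta (Some \<sigma>) x)"
    by (intro add_right_mono) (simp add: kleisli_mono[OF body_pre] assms(3))
  then show ?thesis using assms(1,2) by (simp add: steps_def)
qed

lemma steps_None: "steps f h \<Longrightarrow> h \<sigma> None = kleisli f (body \<sigma>) None"
  unfolding steps_def by (drule spec[of _ \<sigma>], drule spec[of _ None]) simp

lemma iter_0: "iter 0 \<sigma> = lscale top (eta None)"
  by (simp add: iter_def)

lemma iter_Suc: "iter (Suc n) = op (iter n)"
  by (simp add: iter_def)

lemma iter_wfuns: "iter n \<sigma> \<in> wfuns"
  by (induction n arbitrary: \<sigma>) (simp_all add: iter_0 iter_Suc lscale_eta_None_wfuns op_wfuns)

lemmas iter_pre = wfuns_pre[OF iter_wfuns]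

lemma steps_iter: "steps (iter n) (iter (Suc n))"
  unfolding iter_Suc by (intro steps_op iter_wfuns)

lemma iter_ascending: "ascending (\<lambda>n. iter n \<sigma> (Some y))"
proof -
  have "iter n \<sigma> (Some y) \<le> iter (Suc n) \<sigma> (Some y)" for n
  proof (induction n arbitrary: \<sigma>)
    case 0
    then show ?case by (simp add: iter_0 lscale_def)
  qed (rule steps_mono[OF steps_iter steps_iter])
  then show ?thesis by (simp add: ascending_def)
qed

lemma iter_descending: "descending (\<lambda>n. iter n \<sigma> None)"
proof -
  have "iter (Suc n) \<sigma> None \<le> iter n \<sigma> None" for n
  proof (induction n arbitrary: \<sigma>)
    case 0
    then show ?case by (simp add: iter_0 lscale_def)
  qed (rule steps_mono[OF steps_iter steps_iter])
  then show ?thesis by (simp add: descending_def)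
qed

lemma iter_div: "iter n \<sigma> None * top = iter n \<sigma> None"
  using iter_pre by (auto simp: pre_wfuns_def)

lemma limit_Some: "is_lub (range (\<lambda>n. iter n \<sigma> (Some y))) (limit \<sigma> (Some y))"
  using someI_ex[OF directed_sup[OF directed_range_ascending[OF iter_ascending]]]
  by (simp add: limit_def)

lemma limit_None: "is_glb (range (\<lambda>n. iter n \<sigma> None)) (limit \<sigma> None)"
proof -
  have "range (\<lambda>n. iter n \<sigma> None) \<subseteq> div_weights" by (auto simp: div_weights_iff iter_div)
  from someI_ex[OF div_inf[OF this iter_descending]] show ?thesis by (simp add: limit_def)
qed

lemma limit_div: "limit \<sigma> None * top = limit \<sigma> None"
  by (rule is_glb_div_weight[OF limit_None iter_div])

lemma limit_pre: "limit \<sigma> \<in> pre_wfuns"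
proof -
  \<comment> \<open>The masses of the unrollings need not be monotone, as the weight of natural
    decreases. With that weight frozen at its infimum they ascend, and each is bounded by the
    defined total of an unrolling.\<close>
  let ?g = "\<lambda>n x. Some (if x = None then limit \<sigma> None else iter n \<sigma> x)"
  have "supp (limit \<sigma>) \<subseteq> insert None (\<Union>n. supp (iter n \<sigma>))"
  proof
    fix x assume x: "x \<in> supp (limit \<sigma>)"
    show "x \<in> insert None (\<Union>n. supp (iter n \<sigma>))"
    proof (rule ccontr)
      assume notin: "\<not> ?thesis"
      then obtain y where y: "x = Some y" by auto
      have "iter n \<sigma> x = 0" for n using notin by (auto simp: supp_def)
      then have "is_lub (range (\<lambda>n. iter n \<sigma> x)) 0" by (simp add: is_lub_def)
      then have "limit \<sigma> x = 0" using limit_Some is_lub_unique y by blast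
      with x show False by (simp add: supp_def)
    qed
  qed
  moreover have "countable (insert None (\<Union>n. supp (iter n \<sigma>)))"
    using iter_pre by (auto simp: pre_wfuns_def)
  ultimately have "countable (supp (limit \<sigma>))" by (rule countable_subset)
  moreover have "wtotal (limit \<sigma>) UNIV \<noteq> None"
  proof (rule is_lub_not_None)
    have asc: "ascending (\<lambda>n. ?g n x)" for x
      using iter_ascending[of \<sigma>] by (cases x) (auto simp: ascending_def)
    then have "ascending (\<lambda>n. esum (?g n) UNIV)"
      unfolding ascending_def by (blast intro: esum_mono)
    then show "directed (range (\<lambda>n. esum (?g n) UNIV))" by (rule directed_range_ascending)
    have lub: "is_lub (range (\<lambda>n. ?g n x)) (Some (limit \<sigma> x))" for x
    proof (cases x)
      case None
      then show ?thesis by (simp add: is_lub_def)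
    next
      case (Some y)
      then show ?thesis using limit_Some[of \<sigma> y] by (simp add: is_lub_range_Some_iff)
    qed
    show "is_lub (range (\<lambda>n. esum (?g n) UNIV)) (wtotal (limit \<sigma>) UNIV)"
      by (rule is_lub_range_esum[OF asc lub])
    have "esum (?g n) UNIV \<noteq> None" for n
    proof -
      obtain t where "wtotal (iter n \<sigma>) UNIV = Some t" using iter_pre by (rule pre_wfunsE)
      then show ?thesis
        by (rule wtotal_mono[where f = "\<lambda>x. if x = None then limit \<sigma> None else iter n \<sigma> x"])
          (use limit_None[of \<sigma>] in \<open>auto simp: is_glb_def\<close>)
    qed
    then show "None \<notin> range (\<lambda>n. esum (?g n) UNIV)"
      unfolding image_iff by (simp del: not_None_eq add: eq_commute[of None])
  qed
  ultimately show ?thesis by (simp add: pre_wfuns_def limit_div)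
qed

lemma steps_limit: "steps limit limit"
  unfolding steps_def
proof (intro allI)
  fix \<sigma> x
  show "Some (kleisli limit (body \<sigma>) x) + Some (gval e2 \<sigma> * eta (Some \<sigma>) x) = Some (limit \<sigma> x)"
  proof (cases x)
    case None
    have "is_glb (range (\<lambda>n. divw (body \<sigma>) (\<lambda>\<tau>. iter n \<tau> None))) (divw (body \<sigma>) (\<lambda>\<tau>. limit \<tau> None))"
      by (rule fusion_contD)
        (use body_wfuns' in \<open>auto simp: wfuns_iff iter_div iter_descending limit_None\<close>)
    then have "is_glb (range (\<lambda>n. iter (Suc n) \<sigma> None)) (kleisli limit (body \<sigma>) None)"
      unfolding steps_None[OF steps_iter] kleisli_None .
    then have "kleisli limit (body \<sigma>) None = limit \<sigma> None"
      using is_glb_range_Suc[OF iter_descending limit_None] by (rule is_glb_unique)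
    then show ?thesis by (simp add: None)
  next
    case (Some y)
    let ?k = "\<lambda>n. kleisli (iter n) (body \<sigma>) x" and ?r = "Some (gval e2 \<sigma> * eta (Some \<sigma>) x)"
    have "is_lub (range (\<lambda>n. Some (?k n))) (Some (kleisli limit (body \<sigma>) x))"
      unfolding is_lub_range_Some_iff Some
      by (intro kleisli_lub body_pre iter_ascending limit_Some)
    moreover have "directed (range (\<lambda>n. Some (?k n)))"
    proof (rule directed_range_ascending)
      show "ascending (\<lambda>n. Some (?k n))"
        using iter_ascending Some by (auto simp: ascending_def intro: kleisli_mono body_pre)
    qed
    \<comment> \<open>Continuity is applied in the extension, so definedness of the sum at the limit
      comes out of the comparison with \<open>Some (limit \<sigma> x)\<close> and need not be shown
      beforehand.\<close>
    ultimately have "is_lub ((\<lambda>z. z + ?r) ` range (\<lambda>n. Some (?k n))) (Some (kleisli limit (body \<sigma>) x) + ?r)"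
      by (intro option_add_Scott)
    then have "is_lub (range (\<lambda>n. Some (iter (Suc n) \<sigma> x))) (Some (kleisli limit (body \<sigma>) x) + ?r)"
      using steps_iter by (simp add: image_image steps_def)
    moreover have "is_lub (range (\<lambda>n. Some (iter (Suc n) \<sigma> x))) (Some (limit \<sigma> x))"
      unfolding is_lub_range_Some_iff Some by (rule is_lub_range_Suc[OF iter_ascending limit_Some])
    ultimately show ?thesis by (rule is_lub_unique)
  qed
qed

text \<open>One unrolling read at weights \<open>d\<close>: the body followed by \<open>f\<close>,
  or exit followed by divergence. Limit and unrollings obey the same recurrence, so they can be
  compared by induction.\<close>

lemma divw_steps:
  assumes "steps f h" "\<And>\<sigma>. f \<sigma> \<in> pre_wfuns" "\<And>\<sigma>. h \<sigma> \<in> pre_wfuns"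
  shows "Some (divw (h \<sigma>) d) = Some (divw (body \<sigma>) (\<lambda>\<tau>. divw (f \<tau>) d)) + Some (gval e2 \<sigma> * d \<sigma>)"
proof -
  have "Some (divw (kleisli f (body \<sigma>)) d) + Some (divw (lscale (gval e2 \<sigma>) (eta (Some \<sigma>))) d) =
      Some (divw (h \<sigma>) d)"
    unfolding divw_def using assms
    by (intro kleisli_add kleisli_pre_wfuns body_pre lscale_pre_wfuns eta_pre_wfuns)
      (auto simp: steps_def lscale_def)
  then show ?thesis
    by (simp add: divw_lscale_eta divw_kleisli[OF body_pre assms(2)])
qed

text \<open>The fusion order does not give this, as the limit is larger on states and smaller at
  natural. What counts is that an unrolling puts \<open>top\<close> where it stops: the base case is
  \<open>top\<close>, and the recurrence is monotone in what follows the body.\<close>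

lemma divw_limit_le: "divw (limit \<sigma>) d \<le> divw (iter n \<sigma>) d"
proof (induction n arbitrary: \<sigma>)
  case 0
  have "divw (iter 0 \<sigma>) d = top"
    unfolding divw_def iter_0 by (subst kleisli_lscale_eta) (simp_all add: lscale_def)
  then show ?case by simp
next
  case (Suc n)
  have "Some (divw (limit \<sigma>) d) \<le> Some (divw (iter (Suc n) \<sigma>) d)"
    unfolding divw_steps[OF steps_limit limit_pre limit_pre] divw_steps[OF steps_iter iter_pre iter_pre]
    by (intro add_right_mono) (simp add: divw_mono body_pre Suc)
  then show ?case by simp
qed

text \<open>The order in which infima are taken matters. A lower bound \<open>b\<close> for the
  limit is one of \<open>divw (iter k \<sigma>) (d n)\<close> for all \<open>k\<close> and
  \<open>n\<close>. For fixed \<open>k\<close>, \<open>fusion_cont\<close> of the unrolling handles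
  the infimum over \<open>n\<close>; only then does \<open>div_padd_inf\<close> handle the passage
  in \<open>k\<close>.\<close>

lemma limit_wfuns: "limit \<sigma> \<in> wfuns"
proof -
  have "fusion_cont (limit \<sigma>)"
  proof (rule fusion_contI)
    fix d :: "nat \<Rightarrow> 's \<Rightarrow> 'u" and i
    assume d: "\<And>n \<tau>. d n \<tau> * top = d n \<tau>" "\<And>\<tau>. descending (\<lambda>n. d n \<tau>)"
      and i: "\<And>\<tau>. is_glb (range (\<lambda>n. d n \<tau>)) (i \<tau>)"
    have i_div: "i \<tau> * top = i \<tau>" for \<tau> using i d(1) by (rule is_glb_div_weight)
    \<comment> \<open>The contribution of the states at the limiting weights \<open>i\<close>. It
      ascends along the unrollings; \<open>a\<close> and \<open>s\<close> are its values as plain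
      weights.\<close>
    define A where "A m = wtotal (\<lambda>\<tau>. m (Some \<tau>) * i \<tau>) UNIV" for m
    have A_Some: "A m \<noteq> None" if "m \<in> pre_wfuns" for m
      using divw_split[OF that, of i] by (metis A_def None_plus(2) option.distinct(1))
    then have "\<forall>n. \<exists>a. A (iter n \<sigma>) = Some a" using iter_pre by blast
    then obtain a where a: "\<And>n. A (iter n \<sigma>) = Some (a n)" by metis
    obtain s where s: "A (limit \<sigma>) = Some s" using A_Some limit_pre by blast
    have a_div: "a n * top = a n" for n
      using wtotal_mult_right[OF a[unfolded A_def], of n top] a[of n]
      by (simp add: A_def mult.assoc i_div)
    have asc: "ascending (\<lambda>n. Some (iter n \<sigma> (Some \<tau>) * i \<tau>))" for \<tau>
      using iter_ascending by (auto simp: ascending_def intro: weight_mult_right_mono)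
    have "is_lub (range (\<lambda>n. A (iter n \<sigma>))) (A (limit \<sigma>))"
      unfolding A_def
    proof (rule is_lub_range_esum[OF asc])
      fix \<tau>
      have "is_lub (range (\<lambda>n. iter n \<sigma> (Some \<tau>) * i \<tau>)) (limit \<sigma> (Some \<tau>) * i \<tau>)"
        using mult_Scott_right[OF directed_range_ascending[OF iter_ascending] limit_Some, of "i \<tau>"]
        by (simp add: image_image)
      then show "is_lub (range (\<lambda>n. Some (iter n \<sigma> (Some \<tau>) * i \<tau>))) (Some (limit \<sigma> (Some \<tau>) * i \<tau>))"
        by (simp add: is_lub_range_Some_iff)
    qed
    then have a_lub: "is_lub (range a) s" by (simp add: a s is_lub_range_Some_iff)
    have "A (iter n \<sigma>) \<le> A (iter (Suc n) \<sigma>)" for n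
      unfolding A_def using asc by (intro esum_mono) (simp add: ascending_def)
    then have a_asc: "ascending a" by (simp add: a ascending_def)
    show "is_glb (range (\<lambda>n. divw (limit \<sigma>) (d n))) (divw (limit \<sigma>) i)"
      unfolding is_glb_def
    proof (intro conjI ballI allI impI)
      fix x assume "x \<in> range (\<lambda>n. divw (limit \<sigma>) (d n))"
      then show "divw (limit \<sigma>) i \<le> x" using i by (auto simp: is_glb_def intro!: divw_mono limit_pre)
    next
      fix b assume "\<forall>x\<in>range (\<lambda>n. divw (limit \<sigma>) (d n)). b \<le> x"
      then have "b \<le> divw (iter k \<sigma>) (d n)" for k n
        using divw_limit_le[of \<sigma> "d n" k] by (auto intro: order_trans)
      moreover have "is_glb (range (\<lambda>n. divw (iter k \<sigma>) (d n))) (divw (iter k \<sigma>) i)" for k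
        by (rule fusion_contD) (use iter_wfuns d i in \<open>auto simp: wfuns_iff\<close>)
      ultimately have le: "b \<le> divw (iter k \<sigma>) i" for k by (auto simp: is_glb_def)
      have "\<exists>v. padd s (limit \<sigma> None) = Some v \<and> b \<le> v"
      proof (rule div_padd_inf)
        show "\<exists>v. padd (a n) (iter n \<sigma> None) = Some v \<and> b \<le> v" for n
          using divw_split[OF iter_pre, of n \<sigma> i, symmetric] a[of n] le[of n]
          by (simp add: A_def Some_plus_Some padd_commute[of "a n"])
      qed (use a_div a_asc a_lub iter_div iter_descending limit_None in \<open>auto simp: div_weights_iff\<close>)
      then show "b \<le> divw (limit \<sigma>) i"
        using divw_split[OF limit_pre, of \<sigma> i, symmetric] s
        by (auto simp: A_def Some_plus_Some padd_commute[of s])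
    qed
  qed
  with limit_pre show ?thesis by (simp add: wfuns_iff)
qed

lemma limit_least:
  assumes g: "\<And>\<sigma>. g \<sigma> \<in> wfuns" "op g = g"
  shows "fusion_le (limit \<sigma>) (g \<sigma>)"
proof -
  have steps: "steps g g" using steps_op[of g] g by simp
  have "iter n \<sigma> (Some y) \<le> g \<sigma> (Some y) \<and> g \<sigma> None \<le> iter n \<sigma> None" for n \<sigma> y
  proof (induction n arbitrary: \<sigma> y)
    case 0
    then show ?case by (simp add: iter_0 lscale_def)
  next
    case (Suc n)
    then show ?case
      using steps_mono[OF steps_iter steps] steps_mono[OF steps steps_iter] by blast
  qed
  then show ?thesis
    using limit_Some[of \<sigma>] limit_None[of \<sigma>]
    unfolding fusion_le_def is_lub_def is_glb_def by blast
qed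

lemma fixpoint_eq_limit: "(THE f. is_lfp op f) = limit"
proof (rule the_equality)
  show lfp: "is_lfp op limit"
    using limit_wfuns limit_least steps_imp_op[OF steps_limit] by (simp add: is_lfp_def)
  fix f assume f: "is_lfp op f"
  show "f = limit"
  proof (intro ext)
    fix \<sigma> x
    have "fusion_le (f \<sigma>) (limit \<sigma>)" "fusion_le (limit \<sigma>) (f \<sigma>)"
      using f lfp unfolding is_lfp_def by blast+
    then show "f \<sigma> x = limit \<sigma> x" by (cases x) (auto simp: fusion_le_def intro: antisym)
  qed
qed

section \<open>The run of a loop from a fixed weighting\<close>

context
  fixes m :: "nat \<Rightarrow> ('s, 'u) weighting"
  assumes m0: "m 0 \<in> wfuns" and m_Suc: "m (Suc n) = kleisli body (m n)"
begin

lemma states_wfuns: "m n \<in> wfuns"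
  by (induction n) (auto simp: m0 m_Suc intro: kleisli_wfuns body_wfuns')

lemmas states_pre = wfuns_pre[OF states_wfuns]

text \<open>An unrolling peels off the first round, not the last, so the induction moves the start
  from \<open>k\<close> to \<open>Suc k\<close> and needs the statement for every
  \<open>k\<close>.\<close>

lemma kleisli_iter_Some:
  "Some (kleisli (iter n) (m k) (Some y)) = (\<Sum>j<n. Some (m (k + j) (Some y) * gval e2 y))"
proof (induction n arbitrary: k)
  case 0
  have "lift_kernel (iter 0) x (Some y) = 0" for x by (cases x) (simp_all add: iter_0 lscale_def)
  then have "Some (kleisli (iter 0) (m k) (Some y)) = 0"
    unfolding kleisli_eq[OF states_pre, symmetric] by (intro esum_neutral) simp
  then show ?case by simp
next
  case (Suc n)
  have "Some (kleisli (iter (Suc n)) (m k) (Some y)) =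
      Some (kleisli (\<lambda>\<sigma>. kleisli (iter n) (body \<sigma>)) (m k) (Some y)) +
      Some (kleisli (\<lambda>\<sigma>. lscale (gval e2 \<sigma>) (eta (Some \<sigma>))) (m k) (Some y))"
    by (rule kleisli_add_kernel[symmetric])
      (use steps_iter[of n] in \<open>auto simp: steps_def lscale_def states_pre\<close>)
  also have "\<dots> = Some (kleisli (iter n) (m (Suc k)) (Some y)) + Some (m k (Some y) * gval e2 y)"
    by (simp add: m_Suc kleisli_assoc[OF states_pre body_pre] kleisli_rscale_kernel[OF states_pre])
  also have "\<dots> = (\<Sum>j<Suc n. Some (m (k + j) (Some y) * gval e2 y))"
    unfolding sum.lessThan_Suc_shift by (simp add: Suc add.commute)
  finally show ?case .
qed

lemma kleisli_iter_None: "kleisli (iter n) (m k) None = mass (m (k + n)) * top"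
proof (induction n arbitrary: k)
  case 0
  \<comment> \<open>States receive the factor \<open>top\<close> from \<open>iter 0\<close>; the
    weight at natural absorbs \<open>top\<close> already.\<close>
  have "m k x * lift_kernel (iter 0) x None = m k x * top" for x
    using states_pre[of k] by (cases x) (auto simp: iter_0 lscale_def pre_wfuns_def)
  then show ?case
    using kleisli_eq[OF states_pre, of k "iter 0" None]
      wtotal_mult_right[OF mass_eq[OF states_pre], of k top] by simp
next
  case (Suc n)
  have "kleisli (iter (Suc n)) (m k) None = kleisli (\<lambda>\<sigma>. kleisli (iter n) (body \<sigma>)) (m k) None"
    by (rule kleisli_cong) (rule steps_None[OF steps_iter])
  also have "\<dots> = kleisli (iter n) (m (Suc k)) None"
    by (simp add: m_Suc kleisli_assoc[OF states_pre body_pre])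
  finally show ?case by (simp add: Suc)
qed

lemma kleisli_limit_Some:
  "wtotal (\<lambda>n. m n (Some y) * gval e2 y) UNIV = Some (kleisli limit (m 0) (Some y))"
proof (rule is_lub_unique)
  show "is_lub (range (\<lambda>n. \<Sum>j<n. Some (m j (Some y) * gval e2 y)))
      (wtotal (\<lambda>n. m n (Some y) * gval e2 y) UNIV)"
    by (rule is_lub_esum_nat)
  have "is_lub (range (\<lambda>n. kleisli (iter n) (m 0) (Some y))) (kleisli limit (m 0) (Some y))"
    by (intro kleisli_lub states_pre iter_ascending limit_Some)
  then show "is_lub (range (\<lambda>n. \<Sum>j<n. Some (m j (Some y) * gval e2 y)))
      (Some (kleisli limit (m 0) (Some y)))"
    unfolding is_lub_range_Some_iff[symmetric] kleisli_iter_Some by simp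
qed

lemma kleisli_limit_None: "is_glb (range (\<lambda>n. mass (m n) * top)) (kleisli limit (m 0) None)"
proof -
  have "is_glb (range (\<lambda>n. divw (m 0) (\<lambda>\<sigma>. iter n \<sigma> None))) (divw (m 0) (\<lambda>\<sigma>. limit \<sigma> None))"
    by (rule fusion_contD) (use m0 in \<open>auto simp: wfuns_iff iter_div iter_descending limit_None\<close>)
  then show ?thesis unfolding kleisli_None[symmetric] kleisli_iter_None by simp
qed

end

end

section \<open>Soundness\<close>

lemma rscale_eq_kleisli_assume:
  assumes "m \<in> pre_wfuns" "None \<notin> supp m" "\<And>\<sigma>. Some \<sigma> \<in> supp m \<Longrightarrow> gval e \<sigma> = u"
  shows "kleisli (den act (Assume e)) m = rscale m u"
proof
  fix y
  have none: "m None = 0" using assms(2) by (simp add: supp_def)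
  have "m (Some \<sigma>) * gval e \<sigma> = m (Some \<sigma>) * u" for \<sigma>
    using assms(3)[of \<sigma>] by (cases "m (Some \<sigma>) = 0") (auto simp: supp_def)
  then show "kleisli (den act (Assume e)) m y = rscale m u y"
    using none by (cases y) (simp_all add: kleisli_rscale_kernel[OF assms(1)] rscale_def)
qed

lemma loop_den:
  fixes act :: "'a \<Rightarrow> 's \<Rightarrow> ('s, 'u::fusion_semiring) weighting"
  assumes "well_defined act (Iter C e1 e2)" "\<And>\<sigma>. den act C \<sigma> \<in> wfuns"
  shows "loop (den act C) e1 e2"
  using assms by unfold_locales auto

lemma den_wfuns:
  fixes act :: "'a \<Rightarrow> 's \<Rightarrow> ('s, 'u::fusion_semiring) weighting"
  assumes act: "\<And>a \<sigma>. act a \<sigma> \<in> wfuns"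
  shows "well_defined act C \<Longrightarrow> den act C \<sigma> \<in> wfuns"
proof (induction C arbitrary: \<sigma>)
  case (Iter C e1 e2)
  then have "loop (den act C) e1 e2" by (intro loop_den) auto
  then show ?case by (simp add: loop.fixpoint_eq_limit loop.limit_wfuns)
qed (auto simp: act wplus_defined_def intro: eta_wfuns lscale_wfuns kleisli_wfuns)

lemma valid_iter:
  fixes act :: "'a \<Rightarrow> 's \<Rightarrow> ('s, 'u::fusion_semiring) weighting"
  assumes act: "\<And>a \<sigma>. act a \<sigma> \<in> wfuns" and wd: "well_defined act (Iter C e e')"
    and phi: "\<And>n. \<phi> n \<subseteq> wfuns"
    and conv: "converges \<psi> \<psi>_inf" and div: "diverges (\<lambda>n. oplus (\<phi> n) (\<zeta> n)) \<zeta>_inf"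
    and true: "\<And>n. entails_true (\<phi> n)" and entails_div: "\<And>n. entails_div (\<zeta> n)"
    and step: "\<And>n. valid act (oplus (\<phi> n) (\<zeta> n)) (Seq (Assume e) C) (oplus (\<phi> (Suc n)) (\<zeta> (Suc n)))"
    and exit: "\<And>n. valid act (\<phi> n) (Assume e') (\<psi> n)"
  shows "valid act (oplus (\<phi> 0) (\<zeta> 0)) (Iter C e e') (oplus \<psi>_inf \<zeta>_inf)"
  unfolding valid_def
proof
  fix m0 assume m0: "m0 \<in> oplus (\<phi> 0) (\<zeta> 0)"
  interpret loop "den act C" e e'
    using wd den_wfuns[OF act] by (intro loop_den) auto
  define m where "m n = (kleisli body ^^ n) m0" for n
  have m0_wfuns: "m 0 \<in> wfuns" and m_Suc: "m (Suc n) = kleisli body (m n)" for n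
    using m0 by (auto simp: m_def oplus_def)
  have body: "den act (Seq (Assume e) C) = body"
    by (rule ext) (simp add: body_def, subst kleisli_lscale_eta, simp_all)
  have m: "m n \<in> oplus (\<phi> n) (\<zeta> n)" for n
  proof (induction n)
    case (Suc n)
    then show ?case using step[of n] unfolding valid_def body m_Suc by blast
  qed (simp add: m_def m0)
  \<comment> \<open>The splitting is chosen afresh in every round; only the sum \<open>m n\<close>
    follows the body. Since \<open>q n\<close> vanishes on states and \<open>p n\<close> at natural,
    the choice is forced.\<close>
  then have "\<forall>n. \<exists>p q. p \<in> \<phi> n \<and> q \<in> \<zeta> n \<and> (\<forall>x. Some (p x) + Some (q x) = Some (m n x))"
    unfolding oplus_def by blast
  then obtain p q where p: "\<And>n. p n \<in> \<phi> n" and q: "\<And>n. q n \<in> \<zeta> n"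
    and pq: "\<And>n x. Some (p n x) + Some (q n x) = Some (m n x)"
    by metis
  have p_None: "p n None = 0" for n
    using true p by (auto simp: entails_true_def supp_def)
  have "q n (Some y) = 0" for n y
    using entails_div[of n] q[of n] by (auto simp: entails_div_def supp_def)
  then have p_Some: "p n (Some y) = m n (Some y)" for n y
    using pq[of n "Some y"] by simp
  define r where "r n = kleisli (den act (Assume e')) (p n)" for n
  have "r n \<in> \<psi> n" for n
    using exit[of n] p[of n] by (auto simp: valid_def r_def)
  with conv obtain r' where r': "r' \<in> \<psi>_inf" "\<And>x. has_wsum (\<lambda>n. r n x) UNIV (r' x)"
    unfolding converges_def by blast
  have "p n \<in> pre_wfuns" for n using p phi wfuns_pre by blast
  then have r: "r n x = (case x of None \<Rightarrow> 0 | Some y \<Rightarrow> m n (Some y) * gval e' y)" for n x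
    unfolding r_def by (cases x) (simp_all add: kleisli_rscale_kernel p_None p_Some)
  have r'_None: "r' None = 0"
    using r'(2)[of None] esum_neutral[of UNIV "\<lambda>n. Some (r n None)"] by (simp add: has_wsum_iff r)
  have r'_Some: "r' (Some y) = kleisli limit (m 0) (Some y)" for y
    using r'(2)[of "Some y"] kleisli_limit_Some[of m, OF m0_wfuns m_Suc, of y]
    by (simp add: has_wsum_iff r)
  obtain i where i: "is_glb (range (\<lambda>n. mass (m n) * top)) i" "lscale i (eta None) \<in> \<zeta>_inf"
    using div m unfolding diverges_def by blast
  have i_eq: "i = kleisli limit (m 0) None"
    using i(1) kleisli_limit_None[of m, OF m0_wfuns m_Suc] by (rule is_glb_unique)
  \<comment> \<open>At every point one of the two summands is zero, so the sum is defined.\<close>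
  have "Some (r' x) + Some (lscale i (eta None) x) = Some (kleisli limit (m 0) x)" for x
    by (cases x) (simp_all add: r'_None r'_Some i_eq lscale_def)
  moreover have "kleisli limit (m 0) \<in> wfuns"
    by (intro kleisli_wfuns m0_wfuns limit_wfuns)
  ultimately have "kleisli limit (m 0) \<in> oplus \<psi>_inf \<zeta>_inf"
    using r'(1) i(2) unfolding oplus_def by blast
  then show "kleisli (den act (Iter C e e')) m0 \<in> oplus \<psi>_inf \<zeta>_inf"
    by (simp add: fixpoint_eq_limit m_def)
qed

text \<open>The containments in \<open>wfuns\<close> are carried along because the rules assert
  \<open>is_assn\<close> only where no other premise implies it, and linearity of Kleisli extension
  is available only for weightings. \<open>well_defined\<close> stands inside the statement since
  the command changes from rule to rule.\<close>

lemma derivable_sound: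
  fixes act :: "'a \<Rightarrow> 's \<Rightarrow> ('s, 'u::fusion_semiring) weighting"
    and ty :: "'t itself"
  assumes act: "\<And>a \<sigma>. act a \<sigma> \<in> wfuns" and ax: "axiom_set act \<Omega>"
    and der: "derivable ty \<Omega> \<phi> C \<psi>"
  shows "\<phi> \<subseteq> wfuns \<and> \<psi> \<subseteq> wfuns \<and> (well_defined act C \<longrightarrow> valid act \<phi> C \<psi>)"
  using der
proof (induction rule: derivable.induct)
  case (Axiom \<phi> C \<psi>)
  then show ?case using ax unfolding axiom_set_def is_assn_def by blast
next
  case (False \<phi> C)
  then show ?case by (auto simp: is_assn_def valid_def)
next
  case (True \<phi> C)
  have "kleisli (den act C) m \<in> wfuns" if "m \<in> wfuns" "well_defined act C" for m
    using that(1) den_wfuns[OF act that(2)] by (rule kleisli_wfuns)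
  with True show ?case by (auto simp: is_assn_def valid_def)
next
  case (Div u C)
  then show ?case
    by (auto simp: diverge_def valid_def kleisli_lscale_eta mult.assoc intro: lscale_eta_None_wfuns)
next
  case (Scale \<phi> C \<psi> u)
  have "kleisli (den act C) (lscale u m) = lscale u (kleisli (den act C) m)" if "m \<in> \<phi>" for m
    using that Scale by (intro kleisli_lscale wfuns_pre) blast
  with Scale show ?case by (auto simp: lscale_assn_def valid_def intro: lscale_wfuns)
next
  case (Disj \<phi>1 C \<psi>1 \<phi>2 \<psi>2)
  then show ?case by (auto simp: valid_def)
next
  case (Conj \<phi>1 C \<psi>1 \<phi>2 \<psi>2)
  then show ?case by (auto simp: valid_def)
next
  case (Choice T \<phi> C \<phi>')
  have "valid act (bigoplus T \<phi>) C (bigoplus T \<phi>')" if wd: "well_defined act C"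
    unfolding valid_def
  proof
    fix m assume "m \<in> bigoplus T \<phi>"
    then obtain ms where m: "m \<in> wfuns" and ms: "\<And>t. t \<in> T \<Longrightarrow> ms t \<in> \<phi> t"
      and sum: "\<And>x. has_wsum (\<lambda>t. ms t x) T (m x)"
      by (auto simp: bigoplus_def)
    have "ms t \<in> pre_wfuns" if "t \<in> T" for t
      using that ms Choice.IH wfuns_pre by blast
    from kleisli_wsum[OF wfuns_pre[OF m] this sum]
    have "has_wsum (\<lambda>t. kleisli (den act C) (ms t) x) T (kleisli (den act C) m x)" for x .
    moreover have "kleisli (den act C) m \<in> wfuns"
      using m den_wfuns[OF act wd] by (rule kleisli_wfuns)
    moreover have "kleisli (den act C) (ms t) \<in> \<phi>' t" if "t \<in> T" for t
      using that ms Choice.IH wd unfolding valid_def by blast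
    ultimately show "kleisli (den act C) m \<in> bigoplus T \<phi>'"
      unfolding bigoplus_def by (intro CollectI conjI exI[of _ "\<lambda>t. kleisli (den act C) (ms t)"]) auto
  qed
  then show ?case by (auto simp: bigoplus_def)
next
  case (Exists T \<phi> C \<phi>')
  then show ?case unfolding valid_def by blast
next
  case (Consequence \<phi>' \<phi> C \<psi> \<psi>')
  then show ?case unfolding valid_def is_assn_def by blast
next
  case (Skip \<phi>)
  have "kleisli (den act Skip) m = m" if "m \<in> \<phi>" for m
    using that Skip by (auto simp: is_assn_def intro: kleisli_eta_kernel wfuns_pre)
  with Skip show ?case by (simp add: valid_def is_assn_def del: den.simps)
next
  case (Seq \<phi> C1 \<zeta> C2 \<psi>)
  have "kleisli (den act (Seq C1 C2)) m = kleisli (den act C2) (kleisli (den act C1) m)"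
    if "m \<in> \<phi>" "well_defined act C1" for m
    using that Seq.IH wfuns_pre[OF den_wfuns[OF act that(2)]]
    by (simp add: kleisli_assoc wfuns_pre subset_iff)
  with Seq show ?case by (auto simp: valid_def simp del: den.simps)
next
  case (Plus \<phi> C1 \<psi>1 C2 \<psi>2)
  have "valid act \<phi> (Plus C1 C2) (oplus \<psi>1 \<psi>2)" if wd: "well_defined act (Plus C1 C2)"
    unfolding valid_def
  proof
    fix m assume m: "m \<in> \<phi>"
    then have pre: "m \<in> wfuns" "m \<in> pre_wfuns" using Plus.IH wfuns_pre by blast+
    have none: "m None = 0" using Plus.hyps m by (auto simp: entails_true_def supp_def)
    have "Some (kleisli (den act C1) m x) + Some (kleisli (den act C2) m x) =
        Some (kleisli (den act (Plus C1 C2)) m x)" for x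
      by (rule kleisli_add_kernel) (use pre none wd in \<open>auto simp: wplus_defined_def wplus_def\<close>)
    moreover have "kleisli (den act (Plus C1 C2)) m \<in> wfuns"
      using pre(1) den_wfuns[OF act wd] by (rule kleisli_wfuns)
    moreover have "kleisli (den act C1) m \<in> \<psi>1" "kleisli (den act C2) m \<in> \<psi>2"
      using m wd Plus.IH by (auto simp: valid_def)
    ultimately show "kleisli (den act (Plus C1 C2)) m \<in> oplus \<psi>1 \<psi>2"
      unfolding oplus_def by blast
  qed
  with Plus show ?case by (auto simp: oplus_def)
next
  case (Assume \<phi> e u)
  have eq: "kleisli (den act (Assume e)) m = rscale m u" if "m \<in> \<phi>" for m
    using that Assume by (intro rscale_eq_kleisli_assume)
      (auto simp: is_assn_def entails_guard_def intro: wfuns_pre)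
  have "kleisli (den act (Assume e)) m \<in> wfuns" if "m \<in> \<phi>" for m
    using that Assume by (intro kleisli_wfuns den_wfuns act) (auto simp: is_assn_def)
  with eq Assume show ?case
    by (auto simp: rscale_assn_def valid_def is_assn_def simp del: den.simps)
next
  case (Iter \<psi>_inf \<zeta>_inf \<zeta> \<psi> \<phi> e C e')
  have "valid act (oplus (\<phi> 0) (\<zeta> 0)) (Iter C e e') (oplus \<psi>_inf \<zeta>_inf)"
    if wd: "well_defined act (Iter C e e')"
    using act wd
  proof (rule valid_iter)
    \<comment> \<open>From the exit premise, whose precondition is \<open>\<phi> n\<close>.\<close>
    show "\<phi> n \<subseteq> wfuns" for n using Iter.IH by blast
    show "valid act (oplus (\<phi> n) (\<zeta> n)) (Seq (Assume e) C) (oplus (\<phi> (Suc n)) (\<zeta> (Suc n)))" for n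
      using Iter.IH wd by simp
    show "valid act (\<phi> n) (Assume e') (\<psi> n)" for n using Iter.IH by simp
  qed (use Iter.hyps in blast)+
  then show ?case by (auto simp: oplus_def)
qed

theorem mainTheorem1:
  fixes act :: "'a \<Rightarrow> 's \<Rightarrow> ('s, 'u::fusion_semiring) weighting"
    and \<Omega> :: "(('s, 'u) assn \<times> ('a, 's, 'u) cmd \<times> ('s, 'u) assn) set"
    and \<phi> \<psi> :: "('s, 'u) assn"
    and C :: "('a, 's, 'u) cmd"
  assumes "\<And>a \<sigma>. act a \<sigma> \<in> wfuns"
    and "axiom_set act \<Omega>"
    and "well_defined act C"
    and "derivable TYPE('t) \<Omega> \<phi> C \<psi>"
  shows "valid act \<phi> C \<psi>"
  using derivable_sound[OF assms(1,2,4)] assms(3) by blast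

end
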